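(* Let $n\in\mathbb{N}$ and let $\mathbb{Z}^n$ be equipped with the standard generating set $S$. Let $F$ be a finite group equipped with any generating set $T$. Then the direct product $(\mathbb{Z}^n\times F, S\cup T)$ is of type $\mathsf{R}$.
   Context: For a metric space $X$ and a real number $r\ge 0$, the Rips complex $R_r(X)$ is the simplicial complex whose simplices are the non-empty finite subsets of $X$ of diameter $\le r$. A marked group is a pair $(G,S)$, where $G$ is a finitely generated group and $S$ is a finite generating set of $G$. The group $G$ is equipped with the word metric $d_S$: $d_S(g,g)=0$ and, for $g\neq h$, $d_S(g,h)$ is the least $k\in\mathbb{N}$ such that $g^{-1}h=s_1\cdots s_k$ for some $s_1,\ldots,s_k\in S\cup S^{-1}$. Write $R_r(G,S)$ for the Rips complex $R_r(G,d_S)$. A marked group $(G,S)$ is of type $\mathsf{R}$ if there exists a real number $r_0\ge 0$ such that for all real $r\ge r_0$ the Rips complex $R_r(G,S)$ is contractible. The standard generating set of $\mathbb{Z}^n$ is the set of the $n$ standard basis vectors. In the direct product $\mathbb{Z}^n\times F$, the sets $S$ and $T$ are identified with $S\times\{e_F\}$ and $\{0\}\times T$, so that $S\cup T$ generates $\mathbb{Z}^n\times F$. *)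

theory Defs
  imports
    "HOL-Analysis.Analysis"
    "HOL-Algebra.Generated_Groups"
    "HOL-Algebra.Elementary_Groups"
    "HOL-Algebra.Product_Groups"
begin

section \<open>Geometric realization of an abstract simplicial complex\<close>

text \<open>
  An abstract simplicial complex is given by the set of its simplices, which are non-empty
  finite sets of vertices. A point of the realization is the function of its barycentric coordinates.
\<close>

definition closed_face :: "'v set \<Rightarrow> ('v \<Rightarrow> real) set" where
  "closed_face \<sigma> = {f. (\<forall>v. 0 \<le> f v) \<and> (\<forall>v. v \<notin> \<sigma> \<longrightarrow> f v = 0) \<and> (\<Sum>v\<in>\<sigma>. f v) = 1}"

text \<open>
  The realization carries the weak (coherent, CW) topology: a set is open iff it meets each closed
  face in an open subset of that face. On the face of a finite \<open>\<sigma>\<close>, the topology of pointwise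
  convergence is the Euclidean one.
\<close>

definition geometric_realization :: "'v set set \<Rightarrow> ('v \<Rightarrow> real) topology" where
  "geometric_realization K = topology (\<lambda>U.
     U \<subseteq> (\<Union>\<sigma>\<in>K. closed_face \<sigma>) \<and>
     (\<forall>\<sigma>\<in>K. openin (subtopology (powertop_real UNIV) (closed_face \<sigma>)) (U \<inter> closed_face \<sigma>)))"

lemma openin_geometric_realization:
  "openin (geometric_realization K) U \<longleftrightarrow>
     U \<subseteq> (\<Union>\<sigma>\<in>K. closed_face \<sigma>) \<and>
     (\<forall>\<sigma>\<in>K. openin (subtopology (powertop_real UNIV) (closed_face \<sigma>)) (U \<inter> closed_face \<sigma>))"
proof -
  have "istopology (\<lambda>U. U \<subseteq> (\<Union>\<sigma>\<in>K. closed_face \<sigma>) \<and>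
     (\<forall>\<sigma>\<in>K. openin (subtopology (powertop_real UNIV) (closed_face \<sigma>)) (U \<inter> closed_face \<sigma>)))"
    (is "istopology ?L")
    unfolding istopology_def
  proof (rule conjI; intro allI impI)
    fix U V assume "?L U" "?L V"
    moreover have "U \<inter> V \<inter> C = (U \<inter> C) \<inter> (V \<inter> C)" for C by blast
    ultimately show "?L (U \<inter> V)" by (auto simp only: openin_Int)
  next
    fix \<U> assume L: "\<forall>U\<in>\<U>. ?L U"
    have "openin (subtopology (powertop_real UNIV) (closed_face \<sigma>)) (\<Union>\<U> \<inter> closed_face \<sigma>)"
      if "\<sigma> \<in> K" for \<sigma>
      unfolding Int_commute[of "\<Union>\<U>"] Int_Union
      by (rule openin_clauses(3)) (use L that in \<open>auto simp: Int_commute\<close>)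
    with L show "?L (\<Union>\<U>)" by blast
  qed
  then show ?thesis
    unfolding geometric_realization_def by simp
qed

lemma topspace_geometric_realization:
  "topspace (geometric_realization K) = (\<Union>\<sigma>\<in>K. closed_face \<sigma>)"
proof -
  have "openin (geometric_realization K) (\<Union>\<sigma>\<in>K. closed_face \<sigma>)"
    unfolding openin_geometric_realization
  proof (intro conjI ballI subset_refl)
    fix \<sigma> assume "\<sigma> \<in> K"
    then have "(\<Union>\<sigma>\<in>K. closed_face \<sigma>) \<inter> closed_face \<sigma> = closed_face \<sigma>" by blast
    then show "openin (subtopology (powertop_real UNIV) (closed_face \<sigma>))
                 ((\<Union>\<sigma>\<in>K. closed_face \<sigma>) \<inter> closed_face \<sigma>)"
      by (simp add: openin_subtopology_refl)
  qed
  then show ?thesis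
    by (metis openin_geometric_realization openin_subset openin_topspace subset_antisym)
qed

section \<open>Rips complexes\<close>

text \<open>The library constant \<open>diameter\<close> is tied to the type class of metric spaces; here the distance
  function is explicit.\<close>

definition diameter_wrt :: "('a \<Rightarrow> 'a \<Rightarrow> real) \<Rightarrow> 'a set \<Rightarrow> real" where
  "diameter_wrt d A = (if A = {} then 0 else SUP (x, y)\<in>A \<times> A. d x y)"

definition rips_complex :: "'a set \<Rightarrow> ('a \<Rightarrow> 'a \<Rightarrow> real) \<Rightarrow> real \<Rightarrow> 'a set set" where
  "rips_complex M d r = {\<sigma>. \<sigma> \<noteq> {} \<and> finite \<sigma> \<and> \<sigma> \<subseteq> M \<and> diameter_wrt d \<sigma> \<le> r}"

lemma rips_complex_iff_pairwise:
  "\<sigma> \<in> rips_complex M d r \<longleftrightarrow>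
     \<sigma> \<noteq> {} \<and> finite \<sigma> \<and> \<sigma> \<subseteq> M \<and> (\<forall>x\<in>\<sigma>. \<forall>y\<in>\<sigma>. d x y \<le> r)"
proof (cases "\<sigma> \<noteq> {} \<and> finite \<sigma>")
  case True
  have "diameter_wrt d \<sigma> \<le> r \<longleftrightarrow> (\<forall>p\<in>\<sigma> \<times> \<sigma>. (case p of (x, y) \<Rightarrow> d x y) \<le> r)"
    using True unfolding diameter_wrt_def by (auto intro!: cSUP_le_iff simp del: split_paired_Ball_Sigma)
  with True show ?thesis by (auto simp: rips_complex_def)
qed (auto simp: rips_complex_def)

section \<open>Marked groups and type R\<close>

locale marked_group = group G for G (structure) +
  fixes S
  assumes finite_gens: "finite S"
    and gens_subset: "S \<subseteq> carrier G"
    and gens_generate: "generate G S = carrier G"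

definition word_dist :: "('a, 'b) monoid_scheme \<Rightarrow> 'a set \<Rightarrow> 'a \<Rightarrow> 'a \<Rightarrow> nat" where
  "word_dist G S g h =
     (if g = h then 0
      else LEAST k. \<exists>ws. length ws = k \<and> set ws \<subseteq> S \<union> m_inv G ` S \<and>
             inv\<^bsub>G\<^esub> g \<otimes>\<^bsub>G\<^esub> h = foldr (\<otimes>\<^bsub>G\<^esub>) ws \<one>\<^bsub>G\<^esub>)"

definition type_R :: "('a, 'b) monoid_scheme \<Rightarrow> 'a set \<Rightarrow> bool" where
  "type_R G S \<longleftrightarrow> marked_group G S \<and>
     (\<exists>r0::real. r0 \<ge> 0 \<and> (\<forall>r\<ge>r0. contractible_space
        (geometric_realization (rips_complex (carrier G) (\<lambda>g h. real (word_dist G S g h)) r))))"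

section \<open>The group \<open>\<int>\<^sup>n\<close>\<close>

definition Z_pow :: "nat \<Rightarrow> (nat \<Rightarrow> int) monoid" where
  "Z_pow n = product_group {..<n} (\<lambda>_. integer_group)"

definition std_gens :: "nat \<Rightarrow> (nat \<Rightarrow> int) set" where
  "std_gens n = (\<lambda>i. \<lambda>j\<in>{..<n}. if j = i then 1 else 0) ` {..<n}"

end

(* The word metric d on Z^n x F differs from the l1 distance of the Z^n-coordinates by a bounded
   amount. A finite set A of l1-diameter at most t + 1 in Z^n has a center: the mean of the 2^n points
   of A that are extreme for the sign vectors lies within (1 - 2^-n) (t + 1) of A, and within the same
   distance of the mean for any superset of diameter at most t + 1. For large t, the factor
   1 - 2^-n absorbs the rounding to Z^n and the finite factor F. Writing a point p of the Rips complex
   R_(t+1) as a combination of the superlevel sets of its coordinates and moving the sets of diameter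
   t + 1 to their centers gives a retraction of R_(t+1) onto R_t. The composites of these retractions
   make R_r a retract of the full simplex on the group, which is contractible. *)

theory Submission
  imports Defs
begin

section \<open>Maps between geometric realizations\<close>

text \<open>Moving vertices alone cannot retract \<open>R_(t+1)\<close> onto \<open>R_t\<close>,
  because all vertices already lie in \<open>R_t\<close> and must stay fixed. So barycenters are
  moved: the superlevel sets of a point form a chain of faces, that is, a simplex of the barycentric
  subdivision, and the map is affine there. The image of a barycenter has to depend on its face
  alone, so that the definitions on different chains agree. This forces two estimates: a center must
  be near the points of its set, and near the centers of the subsets.

  The center exploits that the l1 norm is the maximum of 2^n linear functionals. Whichever of them
  computes the distance from a point of the set to the mean, one of the 2^n averaged minimizers
  contributes nothing positive; this is the saving of the fraction 1/2^n. Rounding and the factor F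
  cost only additive constants, so the proportional saving wins from the radius 2^n (2 n + C + 1)
  on, where C bounds the excess of the word metric over the l1 distance.

  Only retractions between Rips complexes are built, no homotopies between them.\<close>

abbreviation face_topology :: "'v set \<Rightarrow> ('v \<Rightarrow> real) topology" where
  "face_topology \<sigma> \<equiv> subtopology (powertop_real UNIV) (closed_face \<sigma>)"

lemma closed_faceI:
  assumes "\<And>v. 0 \<le> f v" and "\<And>v. v \<notin> \<sigma> \<Longrightarrow> f v = 0" and "(\<Sum>v\<in>\<sigma>. f v) = 1"
  shows "f \<in> closed_face \<sigma>"
  using assms by (auto simp: closed_face_def)

lemma closed_faceD:
  assumes "f \<in> closed_face \<sigma>"
  shows "0 \<le> f v" and "v \<notin> \<sigma> \<Longrightarrow> f v = 0" and "(\<Sum>v\<in>\<sigma>. f v) = 1"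
  using assms by (auto simp: closed_face_def)

lemma closed_face_mono:
  assumes "\<sigma> \<subseteq> \<tau>" and "finite \<tau>"
  shows "closed_face \<sigma> \<subseteq> closed_face \<tau>"
proof
  fix f assume f: "f \<in> closed_face \<sigma>"
  have "(\<Sum>v\<in>\<tau>. f v) = (\<Sum>v\<in>\<sigma>. f v)"
    by (rule sum.mono_neutral_right) (use assms f in \<open>auto simp: closed_face_def\<close>)
  with f assms show "f \<in> closed_face \<tau>"
    by (auto simp: closed_face_def)
qed

lemma continuous_map_coordinate [continuous_intros]:
  "continuous_map (face_topology \<sigma>) euclideanreal (\<lambda>p. p v)"
  by (intro continuous_map_from_subtopology continuous_map_product_projection UNIV_I)

text \<open>Nonnegativity, vanishing off \<open>\<sigma>\<close> and total mass 1 are closed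
  conditions on the coordinates. Hence a set that is closed in one face is closed in the whole
  product.\<close>

lemma closedin_closed_face:
  assumes "finite \<sigma>"
  shows "closedin (powertop_real UNIV) (closed_face \<sigma>)"
proof -
  let ?P = "powertop_real (UNIV :: 'a set)"
  have coord: "continuous_map ?P euclideanreal (\<lambda>p. p v)" for v
    by (intro continuous_map_product_projection UNIV_I)
  have ge: "closedin ?P {p. p v \<in> {0..}}" for v
    using closedin_continuous_map_preimage[OF coord, of "{0..}" v] by simp
  have zero: "closedin ?P {p. p v \<in> {0}}" for v
    using closedin_continuous_map_preimage[OF coord, of "{0}" v] by simp
  have "continuous_map ?P euclideanreal (\<lambda>p. \<Sum>v\<in>\<sigma>. p v)"
    by (intro continuous_map_sum coord assms)
  from closedin_continuous_map_preimage[OF this, of "{1}"]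
  have total: "closedin ?P {p. (\<Sum>v\<in>\<sigma>. p v) \<in> {1}}" by simp
  have "closed_face \<sigma> =
      \<Inter> (range (\<lambda>v. {p. p v \<in> {0..}}) \<union> (\<lambda>v. {p. p v \<in> {0}}) ` (- \<sigma>) \<union> {{p. (\<Sum>v\<in>\<sigma>. p v) \<in> {1}}})"
    by (auto simp: closed_face_def)
  also have "closedin ?P \<dots>"
    by (rule closedin_Inter) (use ge zero total in auto)
  finally show ?thesis .
qed

text \<open>The universal property of the weak topology; with it, maps out of a realization are
  studied on one closed face at a time.\<close>

lemma continuous_map_from_geometric_realization:
  assumes "\<And>\<sigma>. \<sigma> \<in> K \<Longrightarrow> continuous_map (face_topology \<sigma>) Y f"
  shows "continuous_map (geometric_realization K) Y f"
  unfolding continuous_map_def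
proof (intro conjI allI impI)
  show "f \<in> topspace (geometric_realization K) \<rightarrow> topspace Y"
    using assms by (force simp: topspace_geometric_realization continuous_map_def)
next
  fix U assume U: "openin Y U"
  let ?pre = "{x \<in> topspace (geometric_realization K). f x \<in> U}"
  have "openin (face_topology \<sigma>) (?pre \<inter> closed_face \<sigma>)" if "\<sigma> \<in> K" for \<sigma>
  proof -
    have "?pre \<inter> closed_face \<sigma> = {x \<in> topspace (face_topology \<sigma>). f x \<in> U}"
      using that by (auto simp: topspace_geometric_realization)
    with openin_continuous_map_preimage[OF assms[OF that] U] show ?thesis by simp
  qed
  then show "openin (geometric_realization K) ?pre"
    unfolding openin_geometric_realization by (auto simp: topspace_geometric_realization)
qed

lemma closedin_geometric_realization_face:
  assumes "closedin (geometric_realization K) C" and "\<sigma> \<in> K"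
  shows "closedin (face_topology \<sigma>) (C \<inter> closed_face \<sigma>)"
proof -
  let ?U = "topspace (geometric_realization K) - C"
  have "openin (geometric_realization K) ?U"
    using assms(1) by (auto simp: closedin_def)
  then have "openin (face_topology \<sigma>) (?U \<inter> closed_face \<sigma>)"
    using assms(2) by (auto simp: openin_geometric_realization)
  moreover have "?U \<inter> closed_face \<sigma> = topspace (face_topology \<sigma>) - C \<inter> closed_face \<sigma>"
    using assms(2) by (auto simp: topspace_geometric_realization)
  ultimately show ?thesis
    by (simp add: closedin_def)
qed

text \<open>The weak topology can be finer than coordinatewise convergence, but on finitely many
  finite faces the two agree: a closed set of the realization meets their union in a finite union of
  sets closed in the product.\<close>

lemma continuous_map_into_geometric_realization:
  assumes cont: "continuous_map X (powertop_real UNIV) f"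
    and fin: "finite \<T>" "\<And>\<tau>. \<tau> \<in> \<T> \<Longrightarrow> finite \<tau>" and sub: "\<T> \<subseteq> K"
    and im: "\<And>x. x \<in> topspace X \<Longrightarrow> f x \<in> (\<Union>\<tau>\<in>\<T>. closed_face \<tau>)"
  shows "continuous_map X (geometric_realization K) f"
  unfolding continuous_map_closedin
proof (intro conjI allI impI)
  show "f \<in> topspace X \<rightarrow> topspace (geometric_realization K)"
    using im sub by (force simp: topspace_geometric_realization)
next
  fix C assume C: "closedin (geometric_realization K) C"
  have "closedin (powertop_real UNIV) (C \<inter> closed_face \<tau>)" if "\<tau> \<in> \<T>" for \<tau>
    by (rule closedin_trans_full[OF closedin_geometric_realization_face[OF C]])
      (use that sub fin closedin_closed_face in auto)
  then have "closedin X {x \<in> topspace X. f x \<in> C \<inter> closed_face \<tau>}" if "\<tau> \<in> \<T>" for \<tau>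
    using closedin_continuous_map_preimage[OF cont] that by blast
  then have "closedin X (\<Union>\<tau>\<in>\<T>. {x \<in> topspace X. f x \<in> C \<inter> closed_face \<tau>})"
    using fin(1) by (intro closedin_Union) auto
  also have "(\<Union>\<tau>\<in>\<T>. {x \<in> topspace X. f x \<in> C \<inter> closed_face \<tau>}) = {x \<in> topspace X. f x \<in> C}"
    using im by blast
  finally show "closedin X {x \<in> topspace X. f x \<in> C}" .
qed

text \<open>Local compactness of the interval makes the cylinder coherent with the cylinders over
  the faces, so homotopies can also be checked face by face.\<close>

lemma continuous_map_cylinder_geometric_realization:
  fixes h :: "real \<times> ('v \<Rightarrow> real) \<Rightarrow> 'c"
  assumes cont: "\<And>\<sigma>. \<sigma> \<in> K \<Longrightarrow>
    continuous_map (prod_topology (top_of_set {0..1}) (face_topology \<sigma>)) Y h"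
  shows "continuous_map (prod_topology (top_of_set {0..1}) (geometric_realization K)) Y h"
  unfolding continuous_map_def
proof (intro conjI allI impI)
  show "h \<in> topspace (prod_topology (top_of_set {0..1}) (geometric_realization K)) \<rightarrow> topspace Y"
    using cont by (force simp: topspace_geometric_realization continuous_map_def)
next
  fix U assume U: "openin Y U"
  let ?I = "top_of_set {0..1::real}"
  let ?W = "{x \<in> topspace (prod_topology ?I (geometric_realization K)). h x \<in> U}"
  have W: "openin (prod_topology ?I (face_topology \<sigma>))
      {x \<in> topspace (prod_topology ?I (face_topology \<sigma>)). h x \<in> U}" if "\<sigma> \<in> K" for \<sigma>
    by (rule openin_continuous_map_preimage[OF cont[OF that] U])
  show "openin (prod_topology ?I (geometric_realization K)) ?W"
    unfolding openin_prod_topology_alt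
  proof (intro allI impI)
    fix s p assume "(s, p) \<in> ?W"
    then obtain \<sigma> where s: "s \<in> {0..1}" and \<sigma>: "\<sigma> \<in> K" "p \<in> closed_face \<sigma>" and hsp: "h (s, p) \<in> U"
      by (auto simp: topspace_geometric_realization)
    have "(s, p) \<in> {x \<in> topspace (prod_topology ?I (face_topology \<sigma>)). h x \<in> U}"
      using s \<sigma>(2) hsp by simp
    from W[OF \<sigma>(1), unfolded openin_prod_topology_alt, rule_format, OF this]
    obtain A B where A: "openin ?I A" "s \<in> A" and B: "p \<in> B"
      and AB: "A \<times> B \<subseteq> {x \<in> topspace (prod_topology ?I (face_topology \<sigma>)). h x \<in> U}"
      by blast
    obtain O' where O': "open O'" "A = {0..1} \<inter> O'"
      using A(1) by (auto simp: openin_open)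
    obtain e where e: "e > 0" "cball s e \<subseteq> O'"
      using O' A(2) open_contains_cball by blast
    define J where "J = {0..1} \<inter> cball s e"
    have J: "compact J" "J \<subseteq> {0..1}" "J \<subseteq> A"
      using e O' by (auto simp: J_def intro: compact_Int)
    then have compJ: "compactin ?I J"
      by (simp add: compactin_subtopology)
    \<comment> \<open>A neighbourhood found in one face need not be open in the realization.
      Quantifying over the compact neighbourhood \<open>J\<close> of \<open>s\<close> gives a set
      whose trace on every face is open by the tube lemma.\<close>
    define V where "V = {q \<in> topspace (geometric_realization K). \<forall>u\<in>J. h (u, q) \<in> U}"
    have "openin (face_topology \<tau>) (V \<inter> closed_face \<tau>)" if \<tau>: "\<tau> \<in> K" for \<tau>
      unfolding openin_subopen[of _ "V \<inter> closed_face \<tau>"]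
    proof
      fix q assume q: "q \<in> V \<inter> closed_face \<tau>"
      have "\<exists>M N. openin ?I M \<and> openin (face_topology \<tau>) N \<and> J \<subseteq> M \<and> q \<in> N \<and>
          M \<times> N \<subseteq> {x \<in> topspace (prod_topology ?I (face_topology \<tau>)). h x \<in> U}"
        by (rule tube_lemma_left[OF W[OF \<tau>] compJ]) (use q J in \<open>auto simp: V_def\<close>)
      then obtain M N where N: "openin (face_topology \<tau>) N" "J \<subseteq> M" "q \<in> N"
        and MN: "M \<times> N \<subseteq> {x \<in> topspace (prod_topology ?I (face_topology \<tau>)). h x \<in> U}" by blast
      have "N \<subseteq> closed_face \<tau>"
        using openin_subset[OF N(1)] by simp
      then have "N \<subseteq> V \<inter> closed_face \<tau>"
        using N MN \<tau> by (auto simp: V_def topspace_geometric_realization)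
      with N show "\<exists>T. openin (face_topology \<tau>) T \<and> q \<in> T \<and> T \<subseteq> V \<inter> closed_face \<tau>" by blast
    qed
    then have "openin (geometric_realization K) V"
      unfolding openin_geometric_realization by (auto simp: V_def topspace_geometric_realization)
    moreover have "openin ?I ({0..1} \<inter> ball s e)"
      by (auto simp: openin_open)
    moreover have "p \<in> V"
      using \<sigma> J(3) B AB by (auto simp: V_def topspace_geometric_realization)
    moreover have "({0..1} \<inter> ball s e) \<times> V \<subseteq> ?W"
      by (auto simp: V_def J_def)
    ultimately show "\<exists>M N. openin ?I M \<and> openin (geometric_realization K) N \<and> s \<in> M \<and> p \<in> N \<and> M \<times> N \<subseteq> ?W"
      using s e by (intro exI[of _ "{0..1} \<inter> ball s e"] exI[of _ V]) simp
  qed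
qed

text \<open>The straight-line homotopy to a vertex \<open>w\<close> works because adding
  \<open>w\<close> to a finite set of vertices gives a simplex again: the face of
  \<open>\<sigma>\<close> stays inside the face of \<open>insert w \<sigma>\<close>.\<close>

lemma contractible_full_simplex:
  "contractible_space (geometric_realization {A. A \<noteq> {} \<and> finite A \<and> A \<subseteq> M})"
    (is "contractible_space (geometric_realization ?K)")
proof (cases "M = {}")
  case True
  \<comment> \<open>Without vertices the realization is empty, and the empty space counts as
    contractible.\<close>
  then have "geometric_realization ?K = trivial_topology"
    by (simp add: topspace_geometric_realization flip: null_topspace_iff_trivial)
  then show ?thesis by simp
next
  case False
  then obtain w where w: "w \<in> M" by blast
  let ?\<delta> = "\<lambda>v. if v = w then 1 else 0 :: real"
  let ?h = "\<lambda>x. \<lambda>v. (1 - fst x) * snd x v + fst x * ?\<delta> v"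
  have "continuous_map (prod_topology (top_of_set {0..1}) (geometric_realization ?K))
          (geometric_realization ?K) ?h"
  proof (rule continuous_map_cylinder_geometric_realization)
    fix \<sigma> assume \<sigma>: "\<sigma> \<in> ?K"
    let ?X = "prod_topology (top_of_set {0..1::real}) (face_topology \<sigma>)"
    show "continuous_map ?X (geometric_realization ?K) ?h"
    proof (rule continuous_map_into_geometric_realization[where \<T> = "{insert w \<sigma>}"])
      have fst': "continuous_map ?X euclideanreal (\<lambda>x. fst x)"
        using continuous_map_fst[of "top_of_set {0..1::real}"]
        by (rule continuous_map_into_fulltopology)
      have "continuous_map ?X euclideanreal (\<lambda>x. snd x v)" for v
        using continuous_map_compose[OF continuous_map_snd continuous_map_coordinate]
        by (simp add: comp_def)
      with fst' show "continuous_map ?X (powertop_real UNIV) ?h"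
        unfolding continuous_map_componentwise_UNIV
        by (intro allI continuous_intros) auto
    next
      fix x assume x: "x \<in> topspace ?X"
      then have s: "0 \<le> fst x" "fst x \<le> 1" and p: "snd x \<in> closed_face \<sigma>" by auto
      have p': "snd x \<in> closed_face (insert w \<sigma>)"
        using closed_face_mono[of \<sigma> "insert w \<sigma>"] p \<sigma> by auto
      have "?h x \<in> closed_face (insert w \<sigma>)"
      proof (rule closed_faceI)
        have "(\<Sum>v\<in>insert w \<sigma>. ?h x v) =
            (1 - fst x) * (\<Sum>v\<in>insert w \<sigma>. snd x v) + fst x * (\<Sum>v\<in>insert w \<sigma>. ?\<delta> v)"
          by (simp only: sum.distrib sum_distrib_left)
        also have "\<dots> = 1"
          using closed_faceD(3)[OF p'] \<sigma> by (subst sum.delta) auto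
        finally show "(\<Sum>v\<in>insert w \<sigma>. ?h x v) = 1" .
      qed (use s closed_faceD[OF p'] in auto)
      then show "?h x \<in> (\<Union>\<tau>\<in>{insert w \<sigma>}. closed_face \<tau>)" by simp
    qed (use \<sigma> w in auto)
  qed
  then have "homotopic_with (\<lambda>x. True) (geometric_realization ?K) (geometric_realization ?K) id (\<lambda>_. ?\<delta>)"
    unfolding homotopic_with_def by (intro exI[of _ ?h]) auto
  then show ?thesis
    unfolding contractible_space_def by blast
qed

section \<open>Superlevel sets of barycentric coordinates\<close>

text \<open>The layer-cake decomposition of \<open>p\<close>. For a point of a finite face and
  nonempty \<open>A\<close>, the product of this weight with \<open>card A\<close> is the
  barycentric coordinate of \<open>p\<close> at the barycenter of \<open>A\<close> in the
  barycentric subdivision. Using a measure avoids sorting the coordinates.\<close>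

definition layer_weight :: "('v \<Rightarrow> real) \<Rightarrow> 'v set \<Rightarrow> real" where
  "layer_weight p A = measure lborel {s. 0 \<le> s \<and> {v. s < p v} = A}"

lemma layer_weight_nonneg: "0 \<le> layer_weight p A"
  by (simp add: layer_weight_def)

lemma layer_weight_neq_0D:
  assumes "layer_weight p A \<noteq> 0"
  obtains s where "0 \<le> s" and "{v. s < p v} = A"
proof -
  have "{s. 0 \<le> s \<and> {v. s < p v} = A} \<noteq> {}"
    using assms unfolding layer_weight_def by (rule contrapos_nn) (simp only: measure_empty)
  then show thesis using that by blast
qed

text \<open>Superlevel sets are nested. This is why only the images of comparable sets ever have to
  span a common simplex.\<close>

lemma layer_weight_chain:
  assumes "layer_weight p A \<noteq> 0" and "layer_weight p B \<noteq> 0"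
  shows "A \<subseteq> B \<or> B \<subseteq> A"
proof -
  obtain s where "{v. s < p v} = A" using assms(1) by (rule layer_weight_neq_0D)
  moreover obtain t where "{v. t < p v} = B" using assms(2) by (rule layer_weight_neq_0D)
  ultimately show ?thesis by force
qed

text \<open>A level yields \<open>A\<close> exactly if it lies below the values on \<open>A\<close>
  and not below those off \<open>A\<close>. The inserted 0 carries the condition
  \<open>0 \<le> s\<close> and keeps \<open>Max\<close> meaningful when
  \<open>A = \<sigma>\<close>.\<close>

lemma layer_eq_interval:
  fixes p :: "'v \<Rightarrow> real"
  assumes p: "\<And>v. 0 \<le> p v" "\<And>v. v \<notin> \<sigma> \<Longrightarrow> p v = 0"
    and "finite \<sigma>" and "A \<subseteq> \<sigma>" and "A \<noteq> {}"
  shows "{s. 0 \<le> s \<and> {v. s < p v} = A} = {Max (insert 0 (p ` (\<sigma> - A))) ..< Min (p ` A)}"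
proof -
  have finA: "finite A" using assms finite_subset by blast
  have "0 \<le> s \<and> {v. s < p v} = A \<longleftrightarrow>
      (\<forall>x\<in>insert 0 (p ` (\<sigma> - A)). x \<le> s) \<and> (\<forall>x\<in>p ` A. s < x)" for s
    using p(2) assms(4) by (auto simp: set_eq_iff not_less) (metis DiffI not_less)+
  then have "{s. 0 \<le> s \<and> {v. s < p v} = A} =
      {s. (\<forall>x\<in>insert 0 (p ` (\<sigma> - A)). x \<le> s) \<and> (\<forall>x\<in>p ` A. s < x)}"
    by (rule Collect_cong)
  also have "\<dots> = {Max (insert 0 (p ` (\<sigma> - A))) ..< Min (p ` A)}"
    by (rule Set.set_eqI) (use assms(3,5) finA in simp)
  finally show ?thesis .
qed

text \<open>This form, in minima and maxima of finitely many coordinates, yields continuity on a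
  face. The outer \<open>max 0\<close> covers an empty interval.\<close>

lemma layer_weight_eq:
  assumes "\<And>v. 0 \<le> p v" "\<And>v. v \<notin> \<sigma> \<Longrightarrow> p v = 0"
    and "finite \<sigma>" and "A \<subseteq> \<sigma>" and "A \<noteq> {}"
  shows "layer_weight p A = max 0 (Min (p ` A) - Max (insert 0 (p ` (\<sigma> - A))))"
proof -
  have "{s. 0 \<le> s \<and> {v. s < p v} = A} = {Max (insert 0 (p ` (\<sigma> - A))) ..< Min (p ` A)}"
    by (rule layer_eq_interval[OF assms])
  then show ?thesis
    by (simp only: layer_weight_def) (auto simp: measure_def max_def)
qed

text \<open>The levels whose superlevel set contains \<open>v\<close> fill the interval from 0 to
  \<open>p v\<close>; sorting them by superlevel set cuts it into disjoint pieces whose lengths are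
  the weights.\<close>

lemma sum_layer_weight:
  fixes p :: "'v \<Rightarrow> real"
  assumes p: "\<And>v. 0 \<le> p v" "\<And>v. v \<notin> \<sigma> \<Longrightarrow> p v = 0" and fin: "finite \<sigma>"
  shows "(\<Sum>A\<in>Pow \<sigma> - {{}}. layer_weight p A * indicator A v) = p v"
proof -
  let ?L = "\<lambda>A. {s. 0 \<le> s \<and> {v. s < p v} = A}"
  let ?\<A> = "{A \<in> Pow \<sigma>. v \<in> A}"
  have L: "?L A = {Max (insert 0 (p ` (\<sigma> - A))) ..< Min (p ` A)}" if "A \<in> ?\<A>" for A
    by (rule layer_eq_interval) (use that assms in auto)
  have "(\<Sum>A\<in>Pow \<sigma> - {{}}. layer_weight p A * indicator A v) = (\<Sum>A\<in>?\<A>. layer_weight p A)"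
    by (rule sum.mono_neutral_cong_right) (use fin in auto)
  also have "\<dots> = measure lborel (\<Union>A\<in>?\<A>. ?L A)"
    unfolding layer_weight_def
  proof (rule measure_finite_Union[symmetric])
    show "?L ` ?\<A> \<subseteq> sets lborel"
    proof
      fix X assume "X \<in> ?L ` ?\<A>"
      then obtain A where "A \<in> ?\<A>" "X = ?L A" by blast
      then show "X \<in> sets lborel" by (simp only: L) simp
    qed
    show "emeasure lborel (?L A) \<noteq> \<infinity>" if "A \<in> ?\<A>" for A
      unfolding L[OF that] by (rule less_imp_neq[OF emeasure_bounded_finite[OF bounded_Ico]])
  qed (use fin in \<open>auto simp: disjoint_family_on_def\<close>)
  also have "(\<Union>A\<in>?\<A>. ?L A) = {0..<p v}"
  proof (rule Set.set_eqI)
    fix s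
    have "{v. s < p v} \<subseteq> \<sigma>" if "0 \<le> s"
      using p(2) that by fastforce
    then show "s \<in> (\<Union>A\<in>?\<A>. ?L A) \<longleftrightarrow> s \<in> {0..<p v}" by auto
  qed
  also have "measure lborel \<dots> = p v"
    using p by (simp add: measure_def)
  finally show ?thesis .
qed

lemma continuous_map_Min_image:
  assumes "finite A" "A \<noteq> {}" "\<And>v. v \<in> A \<Longrightarrow> continuous_map X euclideanreal (f v)"
  shows "continuous_map X euclideanreal (\<lambda>x. Min ((\<lambda>v. f v x) ` A))"
  using assms
  by (induction A rule: finite_ne_induct) (auto intro!: continuous_intros)

lemma continuous_map_Max_image:
  assumes "finite A" "\<And>v. v \<in> A \<Longrightarrow> continuous_map X euclideanreal (f v)"
  shows "continuous_map X euclideanreal (\<lambda>x. Max (insert 0 ((\<lambda>v. f v x) ` A)))"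
  using assms
proof (induction A rule: finite_induct)
  case (insert a A)
  have "Max (insert 0 ((\<lambda>v. f v x) ` insert a A)) = max (f a x) (Max (insert 0 ((\<lambda>v. f v x) ` A)))" for x
    using insert.hyps(1) by (simp add: insert_commute[of 0])
  with insert show ?case by (auto intro!: continuous_intros)
qed auto

lemma continuous_map_layer_weight:
  assumes "finite \<sigma>" "A \<subseteq> \<sigma>" "A \<noteq> {}"
  shows "continuous_map (face_topology \<sigma>) euclideanreal (\<lambda>p. layer_weight p A)"
proof (rule continuous_map_eq)
  show "continuous_map (face_topology \<sigma>) euclideanreal
      (\<lambda>p. max 0 (Min ((\<lambda>v. p v) ` A) - Max (insert 0 ((\<lambda>v. p v) ` (\<sigma> - A)))))"
    using assms
    by (intro continuous_intros continuous_map_Min_image continuous_map_Max_image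
        continuous_map_coordinate) (auto intro: finite_subset)
  show "max 0 (Min ((\<lambda>v. p v) ` A) - Max (insert 0 ((\<lambda>v. p v) ` (\<sigma> - A)))) = layer_weight p A"
    if "p \<in> topspace (face_topology \<sigma>)" for p
    using that assms by (subst layer_weight_eq[of p \<sigma>]) (auto simp: closed_face_def)
qed

text \<open>By \<open>sum_layer_weight\<close>, \<open>p\<close> is the combination of the vectors \<open>indicator A\<close> with weights
  \<open>layer_weight p A\<close>; \<open>layer_map\<close> moves each \<open>indicator A\<close> to \<open>\<phi> A\<close>.\<close>

definition layer_map :: "('v set \<Rightarrow> 'w \<Rightarrow> real) \<Rightarrow> ('v \<Rightarrow> real) \<Rightarrow> 'w \<Rightarrow> real" where
  "layer_map \<phi> p u = (\<Sum>A\<in>Pow {v. p v \<noteq> 0} - {{}}. layer_weight p A * \<phi> A u)"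

text \<open>The definition sums over subsets of the support and so refers to no face. Superlevel
  sets at nonnegative levels lie in the support, so the further subsets of \<open>\<sigma>\<close>
  have weight 0; the index set thereby becomes constant on a face.\<close>

lemma layer_map_eq:
  assumes p: "p \<in> closed_face \<sigma>" and fin: "finite \<sigma>"
  shows "layer_map \<phi> p u = (\<Sum>A\<in>Pow \<sigma> - {{}}. layer_weight p A * \<phi> A u)"
  unfolding layer_map_def
proof (rule sum.mono_neutral_left)
  show "Pow {v. p v \<noteq> 0} - {{}} \<subseteq> Pow \<sigma> - {{}}"
    using closed_faceD(2)[OF p] by auto
  show "\<forall>A\<in>Pow \<sigma> - {{}} - (Pow {v. p v \<noteq> 0} - {{}}). layer_weight p A * \<phi> A u = 0"
  proof
    fix A assume A: "A \<in> Pow \<sigma> - {{}} - (Pow {v. p v \<noteq> 0} - {{}})"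
    have "layer_weight p A = 0"
    proof (rule ccontr)
      assume "layer_weight p A \<noteq> 0"
      then obtain s where "0 \<le> s" "{v. s < p v} = A" by (rule layer_weight_neq_0D)
      with A show False by auto
    qed
    then show "layer_weight p A * \<phi> A u = 0" by simp
  qed
qed (use fin in simp)

lemma layer_map_indicator:
  assumes p: "p \<in> closed_face \<sigma>" and fin: "finite \<sigma>"
    and \<phi>: "\<And>A. A \<noteq> {} \<Longrightarrow> A \<subseteq> \<sigma> \<Longrightarrow> \<phi> A = indicator A"
  shows "layer_map \<phi> p = p"
proof
  fix u
  have "layer_map \<phi> p u = (\<Sum>A\<in>Pow \<sigma> - {{}}. layer_weight p A * indicator A u)"
    unfolding layer_map_eq[OF p fin] by (rule sum.cong) (use \<phi> in auto)
  also have "\<dots> = p u"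
    using closed_faceD[OF p] fin by (intro sum_layer_weight)
  finally show "layer_map \<phi> p u = p u" .
qed

text \<open>If \<open>\<phi> A\<close> has the mass of \<open>indicator A\<close>, total mass is
  preserved. Support and mass are demanded only at nonzero weight, that is, on the chain belonging
  to \<open>p\<close>.\<close>

lemma layer_map_in_closed_face:
  assumes p: "p \<in> closed_face \<sigma>" and fin: "finite \<sigma>" "finite \<tau>"
    and nonneg: "\<And>A u. A \<noteq> {} \<Longrightarrow> A \<subseteq> \<sigma> \<Longrightarrow> 0 \<le> \<phi> A u"
    and supp: "\<And>A u. A \<noteq> {} \<Longrightarrow> A \<subseteq> \<sigma> \<Longrightarrow> layer_weight p A \<noteq> 0 \<Longrightarrow> u \<notin> \<tau> \<Longrightarrow> \<phi> A u = 0"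
    and mass: "\<And>A. A \<noteq> {} \<Longrightarrow> A \<subseteq> \<sigma> \<Longrightarrow> layer_weight p A \<noteq> 0 \<Longrightarrow> (\<Sum>u\<in>\<tau>. \<phi> A u) = real (card A)"
  shows "layer_map \<phi> p \<in> closed_face \<tau>"
proof (rule closed_faceI)
  show "0 \<le> layer_map \<phi> p u" for u
    unfolding layer_map_eq[OF p fin(1)]
    by (intro sum_nonneg mult_nonneg_nonneg layer_weight_nonneg nonneg) auto
  show "layer_map \<phi> p u = 0" if "u \<notin> \<tau>" for u
    unfolding layer_map_eq[OF p fin(1)]
  proof (rule sum.neutral, rule ballI)
    fix A assume "A \<in> Pow \<sigma> - {{}}"
    with supp[of A u] that show "layer_weight p A * \<phi> A u = 0" by auto
  qed
  have "(\<Sum>u\<in>\<tau>. layer_map \<phi> p u) = (\<Sum>A\<in>Pow \<sigma> - {{}}. layer_weight p A * (\<Sum>u\<in>\<tau>. \<phi> A u))"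
    unfolding layer_map_eq[OF p fin(1)] sum_distrib_left by (rule sum.swap)
  also have "\<dots> = (\<Sum>A\<in>Pow \<sigma> - {{}}. layer_weight p A * (\<Sum>v\<in>\<sigma>. indicator A v))"
  proof (rule sum.cong)
    fix A assume A: "A \<in> Pow \<sigma> - {{}}"
    have "(\<Sum>v\<in>\<sigma>. indicator A v :: real) = real (card A)"
      using A fin by (simp add: indicator_def sum.If_cases Int_absorb1)
    with mass[of A] A show
      "layer_weight p A * (\<Sum>u\<in>\<tau>. \<phi> A u) = layer_weight p A * (\<Sum>v\<in>\<sigma>. indicator A v)" by auto
  qed simp
  also have "\<dots> = (\<Sum>v\<in>\<sigma>. \<Sum>A\<in>Pow \<sigma> - {{}}. layer_weight p A * indicator A v)"
    unfolding sum_distrib_left by (rule sum.swap)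
  also have "\<dots> = (\<Sum>v\<in>\<sigma>. p v)"
    by (intro sum.cong sum_layer_weight refl) (use closed_faceD[OF p] fin in auto)
  also have "\<dots> = 1" by (rule closed_faceD(3)[OF p])
  finally show "(\<Sum>u\<in>\<tau>. layer_map \<phi> p u) = 1" .
qed

text \<open>\<open>N A\<close> spans a face containing \<open>\<phi> A\<close> divided by
  \<open>card A\<close>. The image of a point lies in the face spanned by the union of the
  \<open>N A\<close> over its chain, hence the hypothesis about chains.\<close>

lemma continuous_map_layer_map:
  assumes finK: "\<And>\<sigma>. \<sigma> \<in> K \<Longrightarrow> finite \<sigma>"
    and N: "\<And>\<sigma> A. \<lbrakk>\<sigma> \<in> K; A \<noteq> {}; A \<subseteq> \<sigma>\<rbrakk> \<Longrightarrow> \<phi> A \<in> (\<lambda>f u. real (card A) * f u) ` closed_face (N A)"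
    and finN: "\<And>\<sigma> A. \<lbrakk>\<sigma> \<in> K; A \<noteq> {}; A \<subseteq> \<sigma>\<rbrakk> \<Longrightarrow> finite (N A)"
    and chain: "\<And>\<sigma> \<C>. \<lbrakk>\<sigma> \<in> K; \<C> \<subseteq> Pow \<sigma> - {{}}; \<C> \<noteq> {}; \<And>A B. A \<in> \<C> \<Longrightarrow> B \<in> \<C> \<Longrightarrow> A \<subseteq> B \<or> B \<subseteq> A\<rbrakk>
      \<Longrightarrow> (\<Union>A\<in>\<C>. N A) \<in> L"
  shows "continuous_map (geometric_realization K) (geometric_realization L) (layer_map \<phi>)"
proof (rule continuous_map_from_geometric_realization)
  fix \<sigma> assume \<sigma>: "\<sigma> \<in> K"
  let ?P = "Pow \<sigma> - {{}}"
  have fin: "finite \<sigma>" by (rule finK[OF \<sigma>])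
  have finUN: "finite (\<Union>A\<in>\<C>. N A)" if "\<C> \<subseteq> ?P" for \<C>
  proof (rule finite_UN_I)
    show "finite \<C>" by (rule finite_subset[OF that]) (use fin in simp)
    show "finite (N A)" if "A \<in> \<C>" for A
      by (rule finN[OF \<sigma>]) (use that \<open>\<C> \<subseteq> ?P\<close> in auto)
  qed
  \<comment> \<open>The simplex of \<open>L\<close> that receives a point varies within the face of
    \<open>\<sigma>\<close>, but its vertices come from one finite set, which leaves finitely many
    candidates.\<close>
  let ?\<T> = "{\<tau> \<in> L. \<tau> \<subseteq> (\<Union>A\<in>?P. N A)}"
  have finT: "finite ?\<T>"
    using finUN[of ?P] by (intro finite_subset[of ?\<T> "Pow (\<Union>A\<in>?P. N A)"]) auto
  show "continuous_map (face_topology \<sigma>) (geometric_realization L) (layer_map \<phi>)"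
  proof (rule continuous_map_into_geometric_realization[where \<T> = ?\<T>])
    have "continuous_map (face_topology \<sigma>) euclideanreal (\<lambda>p. layer_map \<phi> p u)" for u
    proof (rule continuous_map_eq)
      show "continuous_map (face_topology \<sigma>) euclideanreal
          (\<lambda>p. \<Sum>A\<in>?P. layer_weight p A * \<phi> A u)"
        by (intro continuous_map_sum continuous_map_real_mult continuous_map_layer_weight fin
            continuous_map_canonical_const) (use fin in auto)
    qed (simp add: layer_map_eq fin)
    then show "continuous_map (face_topology \<sigma>) (powertop_real UNIV) (layer_map \<phi>)"
      by (simp add: continuous_map_componentwise_UNIV)
  next
    fix p assume "p \<in> topspace (face_topology \<sigma>)"
    then have p: "p \<in> closed_face \<sigma>" by simp
    define \<C> where "\<C> = {A \<in> ?P. layer_weight p A \<noteq> 0}"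
    have \<C>: "\<C> \<subseteq> ?P" by (auto simp: \<C>_def)
    have "\<C> \<noteq> {}"
    proof
      assume "\<C> = {}"
      then have "\<And>A. A \<in> ?P \<Longrightarrow> layer_weight p A = 0" by (auto simp: \<C>_def)
      then have "p v = 0" for v
        using sum_layer_weight[of p \<sigma> v] closed_faceD[OF p] fin by simp
      with closed_faceD(3)[OF p] show False by simp
    qed
    then have L: "(\<Union>A\<in>\<C>. N A) \<in> L"
    proof (rule chain[OF \<sigma> \<C>])
      fix A B assume "A \<in> \<C>" "B \<in> \<C>"
      then show "A \<subseteq> B \<or> B \<subseteq> A"
        unfolding \<C>_def by (intro layer_weight_chain[of p]) blast+
    qed
    have "layer_map \<phi> p \<in> closed_face (\<Union>A\<in>\<C>. N A)"
    proof (rule layer_map_in_closed_face[OF p fin finUN[OF \<C>]])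
      fix A assume A: "A \<noteq> {}" "A \<subseteq> \<sigma>"
      obtain f where f: "f \<in> closed_face (N A)" "\<phi> A = (\<lambda>u. real (card A) * f u)"
        using N[OF \<sigma> A] by blast
      show "0 \<le> \<phi> A u" for u using f by (auto simp: closed_face_def)
      assume "layer_weight p A \<noteq> 0"
      then have sub: "N A \<subseteq> (\<Union>A\<in>\<C>. N A)" using A by (auto simp: \<C>_def)
      then have f': "f \<in> closed_face (\<Union>A\<in>\<C>. N A)"
        using f closed_face_mono[OF sub finUN[OF \<C>]] by blast
      show "\<phi> A u = 0" if "u \<notin> (\<Union>A\<in>\<C>. N A)" for u
        using closed_faceD(2)[OF f' that] f by simp
      show "(\<Sum>u\<in>(\<Union>A\<in>\<C>. N A). \<phi> A u) = real (card A)"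
        unfolding f(2) sum_distrib_left[symmetric] closed_faceD(3)[OF f'] by simp
    qed
    moreover have "(\<Union>A\<in>\<C>. N A) \<in> ?\<T>" using L \<C> by auto
    ultimately show "layer_map \<phi> p \<in> (\<Union>\<tau>\<in>?\<T>. closed_face \<tau>)" by blast
  next
    show "finite \<tau>" if "\<tau> \<in> ?\<T>" for \<tau>
      using that finUN[of ?P] finite_subset by blast
  qed (use finT in auto)
qed

section \<open>Rips complexes with centers\<close>

lemma continuous_map_face_inclusion:
  assumes "\<sigma> \<in> K" and "finite \<sigma>"
  shows "continuous_map (face_topology \<sigma>) (geometric_realization K) (\<lambda>p. p)"
  using assms
  by (intro continuous_map_into_geometric_realization[where \<T> = "{\<sigma>}"]
      continuous_map_from_subtopology continuous_map_id[unfolded id_def]) auto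

lemma continuous_map_geometric_realization_mono:
  assumes "L \<subseteq> K" and "\<And>\<sigma>. \<sigma> \<in> L \<Longrightarrow> finite \<sigma>"
  shows "continuous_map (geometric_realization L) (geometric_realization K) (\<lambda>p. p)"
proof (rule continuous_map_from_geometric_realization)
  fix \<sigma> assume "\<sigma> \<in> L"
  with assms show "continuous_map (face_topology \<sigma>) (geometric_realization K) (\<lambda>p. p)"
    by (intro continuous_map_face_inclusion) auto
qed

text \<open>In a chain, the members of \<open>R t\<close> come at the bottom and keep their
  vertices; each later one is replaced by its center. Distances within the image are thus between
  two points of one simplex of \<open>R t\<close>, between a center and a point of its set, or
  between two centers. Both orders of arguments are bounded because \<open>d\<close> is an arbitrary
  function.\<close>

lemma rips_retraction_step:
  fixes M :: "'a set" and d :: "'a \<Rightarrow> 'a \<Rightarrow> nat" and t :: nat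
  defines "R \<equiv> \<lambda>t::nat. rips_complex M (\<lambda>x y. real (d x y)) (real t)"
  assumes z: "\<And>A B. A \<subseteq> B \<Longrightarrow> A \<noteq> {} \<Longrightarrow> B \<in> R (Suc t) \<Longrightarrow>
      z A \<in> M \<and> (\<forall>v\<in>A. d (z A) v \<le> t \<and> d v (z A) \<le> t) \<and> d (z A) (z B) \<le> t \<and> d (z B) (z A) \<le> t"
  shows "\<exists>f. continuous_map (geometric_realization (R (Suc t))) (geometric_realization (R t)) f \<and>
    (\<forall>p\<in>topspace (geometric_realization (R t)). f p = p)"
proof -
  have R: "A \<in> R k \<longleftrightarrow> A \<noteq> {} \<and> finite A \<and> A \<subseteq> M \<and> (\<forall>x\<in>A. \<forall>y\<in>A. d x y \<le> k)" for A k
    by (simp add: R_def rips_complex_iff_pairwise)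
  \<comment> \<open>Keeping all vertices of a simplex of \<open>R t\<close> makes
    \<open>\<phi> A\<close> equal to \<open>indicator A\<close> there, so the map fixes the
    realization of \<open>R t\<close> pointwise.\<close>
  define N where "N A = (if A \<in> R t then A else {z A})" for A
  define \<phi> :: "'a set \<Rightarrow> 'a \<Rightarrow> real" where "\<phi> A u = real (card A) * (indicator (N A) u / real (card (N A)))" for A u
  have sub: "A \<in> R k" if "A \<subseteq> B" "A \<noteq> {}" "B \<in> R k" for A B k
    using that by (auto simp: R intro: finite_subset)
  have finN: "finite (N A) \<and> N A \<noteq> {} \<and> N A \<subseteq> M" if "A \<subseteq> B" "A \<noteq> {}" "B \<in> R (Suc t)" for A B
    using z[OF that] by (auto simp: N_def R)
  have close: "d x y \<le> t \<and> d y x \<le> t"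
    if AB: "A \<subseteq> B" "A \<noteq> {}" "B \<in> R (Suc t)" and xy: "x \<in> N A" "y \<in> N B" for A B x y
  proof (cases "B \<in> R t")
    case True
    with sub[OF AB(1,2) True] AB(1) xy show ?thesis by (auto simp: N_def R)
  next
    case B: False
    then have y: "y = z B" using xy by (simp add: N_def)
    show ?thesis
    proof (cases "A \<in> R t")
      case True
      then have "x \<in> B" using xy AB by (auto simp: N_def)
      then show ?thesis using z[of B B] AB y by auto
    next
      case False
      then have "x = z A" using xy by (simp add: N_def)
      then show ?thesis using z[OF AB] y by simp
    qed
  qed
  have cont: "continuous_map (geometric_realization (R (Suc t))) (geometric_realization (R t)) (layer_map \<phi>)"
  proof (rule continuous_map_layer_map[where N = N])
    fix \<sigma> A assume A: "\<sigma> \<in> R (Suc t)" "A \<noteq> {}" "A \<subseteq> \<sigma>"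
    have "(\<Sum>u\<in>N A. indicator (N A) u / real (card (N A))) = (1::real)"
      using finN[OF A(3,2,1)] by simp
    then have "(\<lambda>u. indicator (N A) u / real (card (N A))) \<in> closed_face (N A)"
      by (intro closed_faceI) auto
    then show "\<phi> A \<in> (\<lambda>f u. real (card A) * f u) ` closed_face (N A)"
      unfolding \<phi>_def by (intro image_eqI[rotated]) auto
    show "finite (N A)" using finN[OF A(3,2,1)] by simp
  next
    fix \<sigma> \<C>
    assume \<sigma>: "\<sigma> \<in> R (Suc t)" and \<C>: "\<C> \<subseteq> Pow \<sigma> - {{}}" "\<C> \<noteq> {}"
      and chain: "\<And>A B. A \<in> \<C> \<Longrightarrow> B \<in> \<C> \<Longrightarrow> A \<subseteq> B \<or> B \<subseteq> A"
    have in\<C>: "A \<subseteq> \<sigma> \<and> A \<noteq> {} \<and> A \<in> R (Suc t)" if "A \<in> \<C>" for A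
      using that \<C>(1) sub[of A \<sigma>] \<sigma> by auto
    have N\<C>: "finite (N A) \<and> N A \<noteq> {} \<and> N A \<subseteq> M" if "A \<in> \<C>" for A
      using finN[of A \<sigma>] in\<C>[OF that] \<sigma> by simp
    have "finite \<C>"
      by (rule finite_subset[OF \<C>(1)]) (use \<sigma> in \<open>simp add: R\<close>)
    then have "finite (\<Union>A\<in>\<C>. N A)"
      using N\<C> by blast
    moreover have "(\<Union>A\<in>\<C>. N A) \<noteq> {}" "(\<Union>A\<in>\<C>. N A) \<subseteq> M"
      using \<C>(2) N\<C> by auto
    moreover have "d x y \<le> t" if "x \<in> N A" "y \<in> N B" "A \<in> \<C>" "B \<in> \<C>" for x y A B
      using chain[OF that(3,4)]
    proof
      assume "A \<subseteq> B"
      from close[OF this _ _ that(1,2)] in\<C> that(3,4) show ?thesis by simp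
    next
      assume "B \<subseteq> A"
      from close[OF this _ _ that(2,1)] in\<C> that(3,4) show ?thesis by simp
    qed
    ultimately show "(\<Union>A\<in>\<C>. N A) \<in> R t" by (auto simp: R)
  qed (simp add: R)
  moreover have "layer_map \<phi> p = p" if "p \<in> topspace (geometric_realization (R t))" for p
  proof -
    obtain \<sigma> where \<sigma>: "\<sigma> \<in> R t" "p \<in> closed_face \<sigma>"
      using \<open>p \<in> _\<close> by (auto simp: topspace_geometric_realization)
    show ?thesis
    proof (rule layer_map_indicator[OF \<sigma>(2)])
      show "finite \<sigma>" using \<sigma> by (simp add: R)
      fix A assume A: "A \<noteq> {}" "A \<subseteq> \<sigma>"
      then have "A \<in> R t" using sub \<sigma>(1) by blast
      then have "N A = A" "card A \<noteq> 0" by (auto simp: N_def R)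
      then show "\<phi> A = indicator A" by (simp add: \<phi>_def fun_eq_iff)
    qed
  qed
  ultimately show ?thesis by blast
qed

text \<open>Every finite set of points lies in \<open>R (r + k)\<close> for some \<open>k\<close>, and the composites of the retractions
  \<open>R (r + k) \<rightarrow> \<dots> \<rightarrow> R r\<close> extend each other. They exhibit \<open>R r\<close> as a retract of the full
  simplex on \<open>M\<close>.\<close>

lemma contractible_rips_complex_nat:
  fixes M :: "'a set" and d :: "'a \<Rightarrow> 'a \<Rightarrow> nat" and r :: nat
  defines "R \<equiv> \<lambda>t::nat. rips_complex M (\<lambda>x y. real (d x y)) (real t)"
  assumes centers: "\<And>t. r \<le> t \<Longrightarrow> \<exists>z. \<forall>A B. A \<subseteq> B \<longrightarrow> A \<noteq> {} \<longrightarrow> B \<in> R (Suc t) \<longrightarrow>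
      z A \<in> M \<and> (\<forall>v\<in>A. d (z A) v \<le> t \<and> d v (z A) \<le> t) \<and> d (z A) (z B) \<le> t \<and> d (z B) (z A) \<le> t"
  shows "contractible_space (geometric_realization (R r))"
proof -
  have R: "A \<in> R k \<longleftrightarrow> A \<noteq> {} \<and> finite A \<and> A \<subseteq> M \<and> (\<forall>x\<in>A. \<forall>y\<in>A. d x y \<le> k)" for A k
    by (simp add: R_def rips_complex_iff_pairwise)
  let ?X = "\<lambda>k. geometric_realization (R (r + k))"
  let ?S = "{A. A \<noteq> {} \<and> finite A \<and> A \<subseteq> M}"
  have "\<exists>f. continuous_map (?X (Suc k)) (?X k) f \<and> (\<forall>p\<in>topspace (?X k). f p = p)" for k
  proof -
    have "r \<le> r + k" by simp
    from centers[OF this] obtain z where z: "\<And>A B. A \<subseteq> B \<Longrightarrow> A \<noteq> {} \<Longrightarrow> B \<in> R (Suc (r + k)) \<Longrightarrow>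
        z A \<in> M \<and> (\<forall>v\<in>A. d (z A) v \<le> r + k \<and> d v (z A) \<le> r + k) \<and>
        d (z A) (z B) \<le> r + k \<and> d (z B) (z A) \<le> r + k" by blast
    show ?thesis
      unfolding R_def add_Suc_right by (rule rips_retraction_step[OF z[unfolded R_def]])
  qed
  then obtain f where f: "\<And>k. continuous_map (?X (Suc k)) (?X k) (f k)"
    and f_id: "\<And>k p. p \<in> topspace (?X k) \<Longrightarrow> f k p = p"
    by metis
  \<comment> \<open>\<open>g k\<close> is the composite of \<open>f 0\<close>, ...,
    \<open>f (k - 1)\<close>, with \<open>f (k - 1)\<close> applied first.\<close>
  define g where "g k = rec_nat (\<lambda>p. p) (\<lambda>j h. h \<circ> f j) k" for k
  have g_Suc: "g (Suc k) = g k \<circ> f k" for k by (simp add: g_def)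
  have g: "continuous_map (?X k) (?X 0) (g k)" for k
  proof (induction k)
    case (Suc k)
    then show ?case unfolding g_Suc using f continuous_map_compose by blast
  qed (simp add: g_def)
  have R_mono: "R i \<subseteq> R j" if "i \<le> j" for i j
    using that by (fastforce simp: R)
  have X_mono: "topspace (?X i) \<subseteq> topspace (?X j)" if "i \<le> j" for i j
    using R_mono[of "r + i" "r + j"] that by (auto simp: topspace_geometric_realization)
  have g_extends: "g j p = g i p" if "i \<le> j" "p \<in> topspace (?X i)" for i j p
    using that(1)
  proof (induction j rule: dec_induct)
    case (step j)
    then have "f j p = p" using f_id X_mono that(2) by blast
    with step show ?case by (simp add: g_Suc)
  qed simp
  \<comment> \<open>The least index is only a canonical choice: by \<open>g_extends\<close>, every
    index whose complex contains the point gives the same value.\<close>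
  define G where "G p = g (LEAST k. p \<in> topspace (?X k)) p" for p
  have G: "G p = g k p" if "p \<in> topspace (?X k)" for k p
    unfolding G_def
    by (rule g_extends[symmetric]) (use that in \<open>auto intro: Least_le LeastI\<close>)
  have "continuous_map (geometric_realization ?S) (?X 0) G"
  proof (rule continuous_map_from_geometric_realization)
    fix \<sigma> assume \<sigma>: "\<sigma> \<in> ?S"
    \<comment> \<open>The diameter of the finite set \<open>\<sigma>\<close>; on its whole face,
      \<open>G\<close> coincides with the single continuous map \<open>g k\<close>.\<close>
    define k where "k = Max ((\<lambda>(x, y). d x y) ` (\<sigma> \<times> \<sigma>))"
    have "d x y \<le> k" if "x \<in> \<sigma>" "y \<in> \<sigma>" for x y
      unfolding k_def by (rule Max_ge) (use that \<sigma> in auto)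
    then have \<sigma>R: "\<sigma> \<in> R (r + k)"
      using \<sigma> by (fastforce simp: R intro: trans_le_add2)
    have "continuous_map (face_topology \<sigma>) (?X 0) (g k \<circ> (\<lambda>p. p))"
      by (rule continuous_map_compose[OF continuous_map_face_inclusion g]) (use \<sigma> \<sigma>R in auto)
    then show "continuous_map (face_topology \<sigma>) (?X 0) G"
    proof (rule continuous_map_eq)
      fix p assume "p \<in> topspace (face_topology \<sigma>)"
      then have "p \<in> topspace (?X k)"
        using \<sigma>R by (auto simp: topspace_geometric_realization)
      then show "(g k \<circ> (\<lambda>p. p)) p = G p" by (simp add: G)
    qed
  qed
  moreover have "continuous_map (?X 0) (geometric_realization ?S) (\<lambda>p. p)"
    by (rule continuous_map_geometric_realization_mono) (auto simp: R)
  moreover have "G p = p" if "p \<in> topspace (?X 0)" for p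
    using G[OF that] by (simp add: g_def)
  ultimately have "retraction_map (geometric_realization ?S) (?X 0) G"
    unfolding retraction_map_def retraction_maps_def by blast
  then show ?thesis
    using contractible_space_retraction_map_image contractible_full_simplex by fastforce
qed

text \<open>The distances are natural numbers, so the fractional part of the radius has no
  effect.\<close>

lemma rips_complex_floor:
  fixes d :: "'a \<Rightarrow> 'a \<Rightarrow> nat"
  assumes "0 \<le> r"
  shows "rips_complex M (\<lambda>x y. real (d x y)) r = rips_complex M (\<lambda>x y. real (d x y)) (real (nat \<lfloor>r\<rfloor>))"
proof -
  have "real k \<le> r \<longleftrightarrow> real k \<le> real (nat \<lfloor>r\<rfloor>)" for k :: nat
    using assms by (metis le_nat_floor of_nat_floor of_nat_le_iff order_trans)
  then show ?thesis
    by (auto simp only: rips_complex_iff_pairwise Set.set_eq_iff)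
qed

section \<open>Centers of finite subsets of \<open>\<int>\<^sup>n\<close>\<close>

definition l1_norm :: "nat \<Rightarrow> (nat \<Rightarrow> 'a::linordered_idom) \<Rightarrow> 'a" where
  "l1_norm n x = (\<Sum>i<n. \<bar>x i\<bar>)"

text \<open>The linear functionals with coefficients 1 and -1, where \<open>E\<close> holds the
  places of the plus signs. The l1 norm is their maximum.\<close>

definition signed_sum :: "nat \<Rightarrow> nat set \<Rightarrow> (nat \<Rightarrow> real) \<Rightarrow> real" where
  "signed_sum n E x = (\<Sum>i<n. if i \<in> E then x i else - x i)"

definition extreme_point :: "nat \<Rightarrow> (nat \<Rightarrow> int) set \<Rightarrow> nat set \<Rightarrow> nat \<Rightarrow> int" where
  "extreme_point n A E = arg_min_on (\<lambda>x. signed_sum n E (\<lambda>i. of_int (x i))) A"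

text \<open>The minimizers are counted with multiplicity, one for each sign pattern, so that the
  favourable pattern always has the share 1/2^n.\<close>

definition mean_extreme_point :: "nat \<Rightarrow> (nat \<Rightarrow> int) set \<Rightarrow> nat \<Rightarrow> real" where
  "mean_extreme_point n A i = (\<Sum>E\<in>Pow {..<n}. of_int (extreme_point n A E i)) / 2 ^ n"

text \<open>Rounding down returns to integer vectors; the center need not belong to
  \<open>A\<close>. The restriction makes it an element of \<open>Z_pow n\<close>.\<close>

definition l1_center :: "nat \<Rightarrow> (nat \<Rightarrow> int) set \<Rightarrow> nat \<Rightarrow> int" where
  "l1_center n A = (\<lambda>i\<in>{..<n}. \<lfloor>mean_extreme_point n A i\<rfloor>)"

lemma l1_norm_nonneg: "0 \<le> l1_norm n x"
  by (simp add: l1_norm_def sum_nonneg)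

lemma l1_norm_triangle: "l1_norm n (\<lambda>i. x i - z i) \<le> l1_norm n (\<lambda>i. x i - y i) + l1_norm n (\<lambda>i. y i - z i)"
  unfolding l1_norm_def sum.distrib[symmetric] by (rule sum_mono) (simp add: abs_if)

lemma l1_norm_commute: "l1_norm n (\<lambda>i. x i - y i) = l1_norm n (\<lambda>i. y i - x i)"
  by (simp add: l1_norm_def abs_minus_commute)

lemma l1_norm_add: "l1_norm n (\<lambda>i. x i + y i) \<le> l1_norm n x + l1_norm n y"
  unfolding l1_norm_def sum.distrib[symmetric] by (rule sum_mono) simp

lemma l1_norm_cong: "(\<And>i. i < n \<Longrightarrow> x i = y i) \<Longrightarrow> l1_norm n x = l1_norm n y"
  by (simp add: l1_norm_def)

lemma of_int_l1_norm: "of_int (l1_norm n x) = (l1_norm n (\<lambda>i. of_int (x i)) :: real)"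
  by (simp add: l1_norm_def)

lemma signed_sum_le_l1_norm: "signed_sum n E x \<le> l1_norm n x"
  unfolding signed_sum_def l1_norm_def by (rule sum_mono) auto

lemma signed_sum_diff: "signed_sum n E (\<lambda>i. x i - y i) = signed_sum n E x - signed_sum n E y"
  unfolding signed_sum_def sum_subtractf[symmetric] by (rule sum.cong) auto

lemma signed_sum_compl: "signed_sum n ({..<n} - E) x = - signed_sum n E x"
  unfolding signed_sum_def sum_negf[symmetric] by (rule sum.cong) auto

lemma signed_sum_mean:
  assumes "finite I" and "I \<noteq> {}"
  shows "signed_sum n E (\<lambda>i. x i - (\<Sum>j\<in>I. y j i) / real (card I)) =
    (\<Sum>j\<in>I. signed_sum n E (\<lambda>i. x i - y j i)) / real (card I)"
proof -
  have "x i - (\<Sum>j\<in>I. y j i) / real (card I) = (\<Sum>j\<in>I. x i - y j i) / real (card I)" for i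
    using assms by (simp add: sum_subtractf field_simps)
  then have "signed_sum n E (\<lambda>i. x i - (\<Sum>j\<in>I. y j i) / real (card I)) =
      (\<Sum>i<n. (\<Sum>j\<in>I. if i \<in> E then x i - y j i else - (x i - y j i)) / real (card I))"
    unfolding signed_sum_def by (intro sum.cong) (auto simp: sum_subtractf diff_divide_distrib)
  also have "\<dots> = (\<Sum>j\<in>I. signed_sum n E (\<lambda>i. x i - y j i)) / real (card I)"
    unfolding signed_sum_def sum_divide_distrib[symmetric] by (subst sum.swap) simp
  finally show ?thesis .
qed

text \<open>Fixing the signs of \<open>x\<close> turns its norm into the value of a linear
  functional, which commutes with the mean.\<close>

lemma l1_norm_eq_signed_sum: "l1_norm n x = signed_sum n {i. 0 \<le> x i} x"
  unfolding l1_norm_def signed_sum_def by (rule sum.cong) auto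

section \<open>Distances to the mean of the extreme points\<close>

lemma extreme_point_in:
  assumes "finite A" "A \<noteq> {}"
  shows "extreme_point n A E \<in> A"
  unfolding extreme_point_def by (rule arg_min_if_finite(1)[OF assms])

lemma extreme_point_le:
  assumes "finite A" "x \<in> A"
  shows "signed_sum n E (\<lambda>i. of_int (extreme_point n A E i)) \<le> signed_sum n E (\<lambda>i. of_int (x i))"
  using arg_min_if_finite(2)[OF assms(1), of "\<lambda>x. signed_sum n E (\<lambda>i. of_int (x i))"] assms(2)
  unfolding extreme_point_def by (metis empty_iff not_less)

lemma mean_extreme_point_eq:
  "mean_extreme_point n A i =
    (\<Sum>E\<in>Pow {..<n}. of_int (extreme_point n A E i)) / real (card (Pow {..<n}))"
  by (simp add: mean_extreme_point_def card_Pow)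

text \<open>The distance from \<open>x\<close> is a signed sum, averaged over the extreme points. The
  extreme point for the opposite signs contributes at most \<open>0\<close>, and each other one at most \<open>t\<close>.\<close>

lemma l1_norm_mean_extreme_point:
  assumes fin: "finite A" and x: "x \<in> A"
    and diam: "\<And>x y. x \<in> A \<Longrightarrow> y \<in> A \<Longrightarrow> l1_norm n (\<lambda>i. real_of_int (x i) - of_int (y i)) \<le> t"
  shows "l1_norm n (\<lambda>i. of_int (x i) - mean_extreme_point n A i) \<le> (1 - 1 / 2 ^ n) * t"
proof -
  let ?P = "Pow {..<n}"
  define E where "E = {i. 0 \<le> of_int (x i) - mean_extreme_point n A i}"
  let ?s = "\<lambda>F. signed_sum n E (\<lambda>i. of_int (x i) - of_int (extreme_point n A F i))"
  have in_P: "{..<n} - E \<in> ?P" by auto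
  have in_A: "extreme_point n A F \<in> A" for F
    by (rule extreme_point_in) (use fin x in auto)
  \<comment> \<open>A minimizer for the complementary signs is a maximizer over \<open>A\<close> for
    the signs \<open>E\<close>, so \<open>x\<close> cannot exceed it.\<close>
  have opposite: "?s ({..<n} - E) \<le> 0"
    using extreme_point_le[OF fin x, of n "{..<n} - E"] by (simp add: signed_sum_compl signed_sum_diff)
  have "(\<Sum>F\<in>?P. ?s F) = ?s ({..<n} - E) + (\<Sum>F\<in>?P - {{..<n} - E}. ?s F)"
    by (rule sum.remove[OF _ in_P]) simp
  also have "\<dots> \<le> 0 + (\<Sum>F\<in>?P - {{..<n} - E}. t)"
    by (rule add_mono[OF opposite sum_mono]) (rule order_trans[OF signed_sum_le_l1_norm diam[OF x in_A]])
  also have "\<dots> = (2 ^ n - 1) * t"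
    using in_P by (simp add: card_Diff_singleton card_Pow of_nat_diff)
  finally have "(\<Sum>F\<in>?P. ?s F) / 2 ^ n \<le> (1 - 1 / 2 ^ n) * t"
    by (simp add: field_simps)
  moreover have "l1_norm n (\<lambda>i. of_int (x i) - mean_extreme_point n A i) = (\<Sum>F\<in>?P. ?s F) / 2 ^ n"
    unfolding l1_norm_eq_signed_sum E_def[symmetric]
    unfolding mean_extreme_point_eq by (subst signed_sum_mean) (auto simp: card_Pow)
  ultimately show ?thesis by simp
qed

text \<open>The extreme points of \<open>A\<close> are points of \<open>B\<close>, hence close to
  the mean of \<open>B\<close> by the previous estimate; averaging over them preserves the
  bound.\<close>

lemma l1_norm_mean_extreme_point_mono:
  assumes fin: "finite B" and AB: "A \<subseteq> B" "A \<noteq> {}"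
    and diam: "\<And>x y. x \<in> B \<Longrightarrow> y \<in> B \<Longrightarrow> l1_norm n (\<lambda>i. real_of_int (x i) - of_int (y i)) \<le> t"
  shows "l1_norm n (\<lambda>i. mean_extreme_point n B i - mean_extreme_point n A i) \<le> (1 - 1 / 2 ^ n) * t"
proof -
  let ?P = "Pow {..<n}"
  define E where "E = {i. 0 \<le> mean_extreme_point n B i - mean_extreme_point n A i}"
  have "extreme_point n A F \<in> B" for F
    using extreme_point_in[of A n F] AB finite_subset[OF AB(1) fin] by blast
  then have "signed_sum n E (\<lambda>i. mean_extreme_point n B i - of_int (extreme_point n A F i)) \<le> (1 - 1 / 2 ^ n) * t"
    (is "?s F \<le> _") for F
    using l1_norm_mean_extreme_point[OF fin _ diam, of "extreme_point n A F"] signed_sum_le_l1_norm[of n E]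
      l1_norm_commute[of n "mean_extreme_point n B"] order_trans by metis
  then have "(\<Sum>F\<in>?P. ?s F) \<le> (\<Sum>F\<in>?P. (1 - 1 / 2 ^ n) * t)"
    by (rule sum_mono)
  also have "\<dots> = 2 ^ n * ((1 - 1 / 2 ^ n) * t)"
    by (simp add: card_Pow)
  finally have "(\<Sum>F\<in>?P. ?s F) / 2 ^ n \<le> (1 - 1 / 2 ^ n) * t"
    by (simp add: divide_le_eq mult.commute)
  moreover have "l1_norm n (\<lambda>i. mean_extreme_point n B i - mean_extreme_point n A i) = (\<Sum>F\<in>?P. ?s F) / 2 ^ n"
    unfolding l1_norm_eq_signed_sum E_def[symmetric]
    unfolding mean_extreme_point_eq[of n A] by (subst signed_sum_mean) (auto simp: card_Pow)
  ultimately show ?thesis by simp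
qed

lemma l1_norm_floor: "l1_norm n (\<lambda>i. x i - of_int \<lfloor>x i\<rfloor>) \<le> (real n :: real)"
proof -
  have "l1_norm n (\<lambda>i. x i - of_int \<lfloor>x i\<rfloor>) \<le> (\<Sum>i<n. 1)"
    unfolding l1_norm_def by (rule sum_mono) linarith
  then show ?thesis by simp
qed

lemma l1_norm_l1_center: "l1_norm n (\<lambda>i. mean_extreme_point n A i - of_int (l1_center n A i)) \<le> real n"
proof -
  have "l1_norm n (\<lambda>i. mean_extreme_point n A i - of_int (l1_center n A i)) =
      l1_norm n (\<lambda>i. mean_extreme_point n A i - of_int \<lfloor>mean_extreme_point n A i\<rfloor>)"
    by (rule l1_norm_cong) (simp add: l1_center_def)
  then show ?thesis using l1_norm_floor[of n "mean_extreme_point n A"] by simp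
qed

text \<open>The saving \<open>(t + 1) / 2 ^ n\<close> is at least \<open>2 * n + C + 1\<close>: it
  pays \<open>n\<close> for the rounding of each of two centers, \<open>C\<close> for the later
  passage to the word metric, and 1 for the descent from \<open>t + 1\<close> to
  \<open>t\<close>.\<close>

lemma l1_center_close:
  fixes t C n :: nat
  assumes fin: "finite B" and AB: "A \<subseteq> B" "A \<noteq> {}"
    and diam: "\<And>x y. x \<in> B \<Longrightarrow> y \<in> B \<Longrightarrow> l1_norm n (\<lambda>i. x i - y i) \<le> int (Suc t)"
    and t: "2 ^ n * (2 * n + C + 1) \<le> t"
  shows "x \<in> A \<Longrightarrow> l1_norm n (\<lambda>i. x i - l1_center n A i) + int C \<le> int t"
    and "l1_norm n (\<lambda>i. l1_center n B i - l1_center n A i) + int C \<le> int t"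
proof -
  let ?c = "mean_extreme_point n"
  have diam': "l1_norm n (\<lambda>i. real_of_int (x i) - of_int (y i)) \<le> real (Suc t)" if "x \<in> B" "y \<in> B" for x y
  proof -
    have "real_of_int (l1_norm n (\<lambda>i. x i - y i)) \<le> real_of_int (int (Suc t))"
      using diam[OF that] by (simp only: of_int_le_iff)
    then show ?thesis by (simp add: of_int_l1_norm)
  qed
  have "real (2 ^ n * (2 * n + C + 1)) \<le> real (Suc t)"
    using t by (simp only: of_nat_le_iff)
  then have "2 * real n + real C + 1 \<le> real (Suc t) / 2 ^ n"
    by (simp add: field_simps)
  then have bound: "(1 - 1 / 2 ^ n) * real (Suc t) + 2 * real n + real C \<le> real t"
    by (simp add: left_diff_distrib)
  show "l1_norm n (\<lambda>i. x i - l1_center n A i) + int C \<le> int t" if x: "x \<in> A"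
  proof -
    have "l1_norm n (\<lambda>i. real_of_int (x i) - ?c A i) \<le> (1 - 1 / 2 ^ n) * real (Suc t)"
      by (rule l1_norm_mean_extreme_point[OF finite_subset[OF AB(1) fin] x]) (use diam' AB in auto)
    moreover note l1_norm_l1_center[of n A]
      l1_norm_triangle[of n "\<lambda>i. real_of_int (x i)" "\<lambda>i. of_int (l1_center n A i)" "?c A"]
    ultimately have "l1_norm n (\<lambda>i. real_of_int (x i) - of_int (l1_center n A i)) + real C \<le> real t"
      using bound by linarith
    then have "real_of_int (l1_norm n (\<lambda>i. x i - l1_center n A i) + int C) \<le> real_of_int (int t)"
      by (simp add: of_int_l1_norm)
    then show ?thesis by (simp only: of_int_le_iff)
  qed
  have "l1_norm n (\<lambda>i. ?c B i - ?c A i) \<le> (1 - 1 / 2 ^ n) * real (Suc t)"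
    by (rule l1_norm_mean_extreme_point_mono[OF fin AB]) (use diam' in auto)
  moreover note l1_norm_l1_center[of n A] l1_norm_l1_center[of n B]
    l1_norm_commute[of n "\<lambda>i. of_int (l1_center n B i)" "?c B"]
    l1_norm_triangle[of n "\<lambda>i. of_int (l1_center n B i)" "\<lambda>i. of_int (l1_center n A i)" "?c B"]
    l1_norm_triangle[of n "?c B" "\<lambda>i. of_int (l1_center n A i)" "?c A"]
  ultimately have "l1_norm n (\<lambda>i. real_of_int (l1_center n B i) - of_int (l1_center n A i)) + real C \<le> real t"
    using bound by linarith
  then have "real_of_int (l1_norm n (\<lambda>i. l1_center n B i - l1_center n A i) + int C) \<le> real_of_int (int t)"
    by (simp add: of_int_l1_norm)
  then show "l1_norm n (\<lambda>i. l1_center n B i - l1_center n A i) + int C \<le> int t"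
    by (simp only: of_int_le_iff)
qed

section \<open>Word metrics\<close>

context group
begin

lemma foldr_mult_closed:
  "set ws \<subseteq> carrier G \<Longrightarrow> foldr (\<otimes>) ws \<one> \<in> carrier G"
  by (induction ws) auto

lemma foldr_mult_append:
  "set us \<subseteq> carrier G \<Longrightarrow> set ws \<subseteq> carrier G \<Longrightarrow>
    foldr (\<otimes>) (us @ ws) \<one> = foldr (\<otimes>) us \<one> \<otimes> foldr (\<otimes>) ws \<one>"
  by (induction us) (auto simp: foldr_mult_closed m_assoc simp del: foldr_append)

lemma symmetrized_subset: "S \<subseteq> carrier G \<Longrightarrow> S \<union> m_inv G ` S \<subseteq> carrier G"
  by auto

lemma generate_imp_word:
  assumes "g \<in> generate G S" and S: "S \<subseteq> carrier G"
  shows "\<exists>ws. set ws \<subseteq> S \<union> m_inv G ` S \<and> foldr (\<otimes>) ws \<one> = g"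
  using assms(1)
proof induction
  case one
  show ?case by (rule exI[of _ "[]"]) simp
next
  case (incl s)
  then show ?case using S by (intro exI[of _ "[s]"]) auto
next
  case (inv s)
  then show ?case using S by (intro exI[of _ "[inv s]"]) auto
next
  case (eng g h)
  then obtain us ws where "set us \<subseteq> S \<union> m_inv G ` S" "foldr (\<otimes>) us \<one> = g"
    and "set ws \<subseteq> S \<union> m_inv G ` S" "foldr (\<otimes>) ws \<one> = h" by blast
  moreover note symmetrized_subset[OF S]
  ultimately show ?case
    using foldr_mult_append[of us ws] by (intro exI[of _ "us @ ws"]) auto
qed

lemma word_imp_generate:
  "set ws \<subseteq> S \<union> m_inv G ` S \<Longrightarrow> foldr (\<otimes>) ws \<one> \<in> generate G S"
  by (induction ws) (auto intro: generate.intros)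

lemma word_dist_le:
  assumes "set ws \<subseteq> S \<union> m_inv G ` S" and "inv g \<otimes> h = foldr (\<otimes>) ws \<one>"
  shows "word_dist G S g h \<le> length ws"
proof -
  have "(LEAST k. \<exists>ws. length ws = k \<and> set ws \<subseteq> S \<union> m_inv G ` S \<and>
      inv g \<otimes> h = foldr (\<otimes>) ws \<one>) \<le> length ws"
    by (rule Least_le) (use assms in blast)
  then show ?thesis by (simp add: word_dist_def)
qed

lemma word_dist_attained:
  assumes S: "S \<subseteq> carrier G" "generate G S = carrier G" and g: "g \<in> carrier G" and h: "h \<in> carrier G"
  obtains ws where "length ws = word_dist G S g h" and "set ws \<subseteq> S \<union> m_inv G ` S"
    and "inv g \<otimes> h = foldr (\<otimes>) ws \<one>"
proof (cases "g = h")
  case True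
  \<comment> \<open>The distance 0 of equal elements is the length of the empty word.\<close>
  then show thesis using that[of "[]"] g by (simp add: word_dist_def)
next
  case False
  let ?P = "\<lambda>k. \<exists>ws. length ws = k \<and> set ws \<subseteq> S \<union> m_inv G ` S \<and> inv g \<otimes> h = foldr (\<otimes>) ws \<one>"
  have "inv g \<otimes> h \<in> generate G S" using S g h by simp
  from generate_imp_word[OF this S(1)] have "\<exists>k. ?P k" by metis
  then have "?P (Least ?P)" by (rule LeastI_ex)
  then show thesis using that False by (auto simp: word_dist_def)
qed

end

section \<open>The marked group \<open>\<int>\<^sup>n \<times> F\<close>\<close>

lemma carrier_Z_pow [simp]: "carrier (Z_pow n) = extensional {..<n}"
  by (simp add: Z_pow_def carrier_product_group PiE_def)

lemma mult_Z_pow [simp]: "x \<otimes>\<^bsub>Z_pow n\<^esub> y = (\<lambda>i\<in>{..<n}. x i + y i)"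
  by (simp add: Z_pow_def)

lemma one_Z_pow [simp]: "\<one>\<^bsub>Z_pow n\<^esub> = (\<lambda>i\<in>{..<n}. 0)"
  by (simp add: Z_pow_def)

lemma group_Z_pow: "group (Z_pow n)"
  by (simp add: Z_pow_def)

lemma inv_Z_pow [simp]:
  assumes "x \<in> extensional {..<n}"
  shows "inv\<^bsub>Z_pow n\<^esub> x = (\<lambda>i\<in>{..<n}. - x i)"
  by (rule group.inv_equality[OF group_Z_pow]) (use assms in \<open>auto simp: fun_eq_iff\<close>)

locale Z_pow_times_finite = F: group F for F (structure) +
  fixes n :: nat and T
  assumes finite_F: "finite (carrier F)"
    and T: "T \<subseteq> carrier F" "generate F T = carrier F"
begin

abbreviation "G \<equiv> Z_pow n \<times>\<times> F"

definition gens where "gens = std_gens n \<times> {\<one>} \<union> {\<one>\<^bsub>Z_pow n\<^esub>} \<times> T"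

sublocale G: group G
  by (rule DirProd_group[OF group_Z_pow F.is_group])

lemma std_gens_extensional: "std_gens n \<subseteq> extensional {..<n}"
  by (auto simp: std_gens_def)

lemma gens_subset: "gens \<subseteq> carrier G"
  using T std_gens_extensional by (auto simp: gens_def)

lemma finite_gens: "finite gens"
  using finite_subset[OF T(1) finite_F] by (auto simp: gens_def std_gens_def)

section \<open>Comparison of the word metric with the l1 distance\<close>

lemma l1_norm_gen:
  assumes "s \<in> gens \<union> m_inv G ` gens"
  shows "l1_norm n (fst s) \<le> 1"
proof -
  have "l1_norm n (\<lambda>j\<in>{..<n}. if j = i then 1 else 0 :: int) = (\<Sum>j<n. if j = i then 1 else 0)" for i
    unfolding l1_norm_def by (rule sum.cong) auto
  then have "l1_norm n (\<lambda>j\<in>{..<n}. if j = i then 1 else 0 :: int) \<le> 1" for i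
    by simp
  moreover have "l1_norm n (\<lambda>j\<in>{..<n}. 0 :: int) = 0"
    by (simp add: l1_norm_def)
  ultimately have gen: "l1_norm n (fst s) \<le> 1" if "s \<in> gens" for s
    using that by (auto simp: gens_def std_gens_def)
  have gen_inv: "l1_norm n (fst (inv\<^bsub>G\<^esub> s)) = l1_norm n (fst s)" if s: "s \<in> gens" for s
  proof -
    have "s \<in> carrier G" using s gens_subset by blast
    then have "inv\<^bsub>G\<^esub> s = (\<lambda>i\<in>{..<n}. - fst s i, inv (snd s))"
      using inv_DirProd[OF group_Z_pow F.is_group, of "fst s" n "snd s"] by auto
    then show ?thesis by (simp add: l1_norm_def)
  qed
  from assms show ?thesis
    by (elim UnE imageE) (simp_all add: gen gen_inv)
qed

text \<open>Each letter moves the integer coordinates by at most one step, and letters from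
  \<open>T\<close> do not move them at all.\<close>

lemma l1_norm_word:
  assumes "set ws \<subseteq> gens \<union> m_inv G ` gens"
  shows "l1_norm n (fst (foldr (\<otimes>\<^bsub>G\<^esub>) ws \<one>\<^bsub>G\<^esub>)) \<le> int (length ws)"
  using assms
proof (induction ws)
  case Nil
  then show ?case by (simp add: l1_norm_def)
next
  case (Cons s ws)
  let ?w = "foldr (\<otimes>\<^bsub>G\<^esub>) ws \<one>\<^bsub>G\<^esub>"
  have "l1_norm n (fst (s \<otimes>\<^bsub>G\<^esub> ?w)) = l1_norm n (\<lambda>i. fst s i + fst ?w i)"
    by (rule l1_norm_cong) (auto simp: mult_DirProd')
  also have "\<dots> \<le> l1_norm n (fst s) + l1_norm n (fst ?w)" by (rule l1_norm_add)
  finally show ?case using Cons l1_norm_gen[of s] by simp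
qed

lemma l1_norm_inv_mult:
  assumes "g \<in> carrier G" "h \<in> carrier G"
  shows "l1_norm n (fst (inv\<^bsub>G\<^esub> g \<otimes>\<^bsub>G\<^esub> h)) = l1_norm n (\<lambda>i. fst g i - fst h i)"
proof -
  have "inv\<^bsub>G\<^esub> g = (\<lambda>i\<in>{..<n}. - fst g i, inv (snd g))"
    using inv_DirProd[OF group_Z_pow F.is_group, of "fst g" n "snd g"] assms by auto
  then have "l1_norm n (fst (inv\<^bsub>G\<^esub> g \<otimes>\<^bsub>G\<^esub> h)) = l1_norm n (\<lambda>i. fst h i - fst g i)"
    by (intro l1_norm_cong) (simp add: mult_DirProd')
  with l1_norm_commute[of n "fst h" "fst g"] show ?thesis by (rule trans[rotated])
qed

lemma word_of_Z_pow:
  assumes "x \<in> extensional {..<n}"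
  shows "\<exists>ws. int (length ws) = l1_norm n x \<and> set ws \<subseteq> gens \<union> m_inv G ` gens \<and>
    foldr (\<otimes>\<^bsub>G\<^esub>) ws \<one>\<^bsub>G\<^esub> = (x, \<one>)"
  using assms
proof (induction "nat (l1_norm n x)" arbitrary: x)
  case 0
  then have norm: "l1_norm n x = 0" using l1_norm_nonneg[of n x] by simp
  then have "x = (\<lambda>i\<in>{..<n}. 0)"
    using 0(2) by (auto simp: l1_norm_def sum_nonneg_eq_0_iff extensional_def)
  with norm show ?case by (intro exI[of _ "[]"]) (simp add: restrict_def)
next
  case (Suc k)
  have "\<exists>i<n. x i \<noteq> 0"
  proof (rule ccontr)
    assume "\<not> ?thesis"
    then have "l1_norm n x = 0" by (simp add: l1_norm_def)
    with Suc(2) show False by simp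
  qed
  then obtain i where i: "i < n" "x i \<noteq> 0" by blast
  let ?e = "\<lambda>j\<in>{..<n}. if j = i then 1 else 0 :: int"
  define s where "s = (\<lambda>j\<in>{..<n}. if j = i then sgn (x i) else 0)"
  define y where "y = (\<lambda>j\<in>{..<n}. x j - s j)"
  have "(?e, \<one>) \<in> gens" using i by (auto simp: gens_def std_gens_def)
  moreover have "inv\<^bsub>G\<^esub> (?e, \<one>) = (\<lambda>j\<in>{..<n}. - ?e j, \<one>)"
    by (subst inv_DirProd[OF group_Z_pow F.is_group]) auto
  moreover have "s = ?e \<or> s = (\<lambda>j\<in>{..<n}. - ?e j)"
    using i by (auto simp: s_def sgn_if fun_eq_iff)
  ultimately have s: "(s, \<one>) \<in> gens \<union> m_inv G ` gens"
    by (elim disjE) (simp, rule UnI2, rule image_eqI[rotated], assumption, simp)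
  have "\<bar>y j\<bar> = \<bar>x j\<bar> - (if j = i then 1 else 0)" if "j < n" for j
    using that i by (auto simp: y_def s_def sgn_if)
  then have "l1_norm n y = (\<Sum>j<n. \<bar>x j\<bar> - (if j = i then 1 else 0))"
    unfolding l1_norm_def by (intro sum.cong) auto
  also have "\<dots> = l1_norm n x - 1"
    using i by (simp add: l1_norm_def sum_subtractf)
  finally have norm: "l1_norm n y = l1_norm n x - 1" .
  have "k = nat (l1_norm n y)" using Suc(2) norm by simp
  moreover have "y \<in> extensional {..<n}" by (simp add: y_def)
  ultimately obtain ws where ws: "int (length ws) = l1_norm n y"
    "set ws \<subseteq> gens \<union> m_inv G ` gens" "foldr (\<otimes>\<^bsub>G\<^esub>) ws \<one>\<^bsub>G\<^esub> = (y, \<one>)"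
    using Suc(1) by blast
  have "(s, \<one>) \<otimes>\<^bsub>G\<^esub> (y, \<one>) = (x, \<one>)"
    using Suc(3) by (auto simp: y_def fun_eq_iff extensional_def)
  with ws s norm show ?case by (intro exI[of _ "(s, \<one>) # ws"]) simp
qed

lemma word_of_F:
  assumes "f \<in> carrier F"
  shows "\<exists>ws. set ws \<subseteq> gens \<union> m_inv G ` gens \<and> foldr (\<otimes>\<^bsub>G\<^esub>) ws \<one>\<^bsub>G\<^esub> = (\<one>\<^bsub>Z_pow n\<^esub>, f)"
proof -
  obtain us where us: "set us \<subseteq> T \<union> m_inv F ` T" "foldr (\<otimes>) us \<one> = f"
    using F.generate_imp_word[OF _ T(1)] assms T(2) by blast
  have "foldr (\<otimes>\<^bsub>G\<^esub>) (map (Pair \<one>\<^bsub>Z_pow n\<^esub>) us) \<one>\<^bsub>G\<^esub> = (\<one>\<^bsub>Z_pow n\<^esub>, foldr (\<otimes>) us \<one>)"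
    by (induction us) (auto simp: fun_eq_iff)
  moreover have mem: "(\<one>\<^bsub>Z_pow n\<^esub>, u) \<in> gens \<union> m_inv G ` gens" if u: "u \<in> T \<union> m_inv F ` T" for u
  proof (cases "u \<in> T")
    case True
    then show ?thesis by (simp add: gens_def)
  next
    case False
    then obtain t where t: "t \<in> T" "u = inv t" using u by blast
    have "inv\<^bsub>G\<^esub> (\<one>\<^bsub>Z_pow n\<^esub>, t) = (inv\<^bsub>Z_pow n\<^esub> \<one>\<^bsub>Z_pow n\<^esub>, inv t)"
      by (rule inv_DirProd[OF group_Z_pow F.is_group]) (use t T in auto)
    then have "(\<one>\<^bsub>Z_pow n\<^esub>, u) = inv\<^bsub>G\<^esub> (\<one>\<^bsub>Z_pow n\<^esub>, t)"
      using t group.is_monoid[OF group_Z_pow[of n]] by (simp only: monoid.inv_one)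
    moreover have "(\<one>\<^bsub>Z_pow n\<^esub>, t) \<in> gens" using t by (simp add: gens_def)
    ultimately show ?thesis by blast
  qed
  moreover have "set (map (Pair \<one>\<^bsub>Z_pow n\<^esub>) us) \<subseteq> gens \<union> m_inv G ` gens"
    unfolding set_map image_subset_iff using mem us(1) by (intro ballI) (rule mem, rule subsetD)
  ultimately show ?thesis
    unfolding us(2) by (intro exI conjI)
qed

text \<open>A pair is the product of its two components, each spelled separately. \<open>C\<close>
  is the greatest length among words chosen once for the finitely many elements of
  \<open>F\<close>.\<close>

lemma word_of_G:
  "\<exists>C::nat. \<forall>g\<in>carrier G. \<exists>ws. int (length ws) \<le> l1_norm n (fst g) + int C \<and>
    set ws \<subseteq> gens \<union> m_inv G ` gens \<and> foldr (\<otimes>\<^bsub>G\<^esub>) ws \<one>\<^bsub>G\<^esub> = g"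
proof -
  obtain w where w: "\<And>f. f \<in> carrier F \<Longrightarrow> set (w f) \<subseteq> gens \<union> m_inv G ` gens \<and>
      foldr (\<otimes>\<^bsub>G\<^esub>) (w f) \<one>\<^bsub>G\<^esub> = (\<one>\<^bsub>Z_pow n\<^esub>, f)"
    using word_of_F by metis
  have "\<exists>ws. int (length ws) \<le> l1_norm n (fst g) + int (Max ((length \<circ> w) ` carrier F)) \<and>
    set ws \<subseteq> gens \<union> m_inv G ` gens \<and> foldr (\<otimes>\<^bsub>G\<^esub>) ws \<one>\<^bsub>G\<^esub> = g" if g: "g \<in> carrier G" for g
  proof -
    obtain x f where xf: "g = (x, f)" "x \<in> extensional {..<n}" "f \<in> carrier F"
      using g by auto
    obtain us where us: "int (length us) = l1_norm n x" "set us \<subseteq> gens \<union> m_inv G ` gens"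
      "foldr (\<otimes>\<^bsub>G\<^esub>) us \<one>\<^bsub>G\<^esub> = (x, \<one>)"
      using word_of_Z_pow[OF xf(2)] by blast
    have "length (w f) \<le> Max ((length \<circ> w) ` carrier F)"
      by (rule Max_ge) (use finite_F xf in auto)
    moreover have "foldr (\<otimes>\<^bsub>G\<^esub>) (us @ w f) \<one>\<^bsub>G\<^esub> = g"
    proof -
      have "foldr (\<otimes>\<^bsub>G\<^esub>) (us @ w f) \<one>\<^bsub>G\<^esub> = (x, \<one>) \<otimes>\<^bsub>G\<^esub> (\<one>\<^bsub>Z_pow n\<^esub>, f)"
        using us(3) w[OF xf(3)]
          G.foldr_mult_append[OF subset_trans[OF us(2)] subset_trans[of "set (w f)"],
            OF G.symmetrized_subset[OF gens_subset] _ G.symmetrized_subset[OF gens_subset]]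
        by (simp only:)
      also have "\<dots> = g"
        using xf extensional_restrict[OF xf(2)] by (simp add: restrict_def cong: if_cong)
      finally show ?thesis .
    qed
    ultimately show ?thesis
      using us w[OF xf(3)] xf(1) by (intro exI[of _ "us @ w f"]) auto
  qed
  then show ?thesis by blast
qed

lemma generate_gens: "generate G gens = carrier G"
proof
  show "generate G gens \<subseteq> carrier G" by (rule G.generate_incl[OF gens_subset])
  show "carrier G \<subseteq> generate G gens"
  proof
    fix g assume "g \<in> carrier G"
    with word_of_G obtain ws where "set ws \<subseteq> gens \<union> m_inv G ` gens"
      "foldr (\<otimes>\<^bsub>G\<^esub>) ws \<one>\<^bsub>G\<^esub> = g" by meson
    then show "g \<in> generate G gens" using G.word_imp_generate by metis
  qed
qed

text \<open>This direction has no additive error, so projecting to the integer coordinates does not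
  increase diameters; \<open>C\<close> is paid only on the way back.\<close>

lemma l1_norm_le_word_dist:
  assumes "g \<in> carrier G" "h \<in> carrier G"
  shows "l1_norm n (\<lambda>i. fst g i - fst h i) \<le> int (word_dist G gens g h)"
proof -
  obtain ws where "length ws = word_dist G gens g h" "set ws \<subseteq> gens \<union> m_inv G ` gens"
    "inv\<^bsub>G\<^esub> g \<otimes>\<^bsub>G\<^esub> h = foldr (\<otimes>\<^bsub>G\<^esub>) ws \<one>\<^bsub>G\<^esub>"
    by (rule G.word_dist_attained[OF gens_subset generate_gens assms])
  then show ?thesis
    using l1_norm_word[of ws] l1_norm_inv_mult[OF assms] by simp
qed

lemma word_dist_le_l1_norm:
  "\<exists>C::nat. \<forall>g\<in>carrier G. \<forall>h\<in>carrier G.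
    int (word_dist G gens g h) \<le> l1_norm n (\<lambda>i. fst g i - fst h i) + int C"
proof -
  obtain C :: nat where C: "\<And>g. g \<in> carrier G \<Longrightarrow> \<exists>ws. int (length ws) \<le> l1_norm n (fst g) + int C \<and>
    set ws \<subseteq> gens \<union> m_inv G ` gens \<and> foldr (\<otimes>\<^bsub>G\<^esub>) ws \<one>\<^bsub>G\<^esub> = g"
    using word_of_G by blast
  have "int (word_dist G gens g h) \<le> l1_norm n (\<lambda>i. fst g i - fst h i) + int C"
    if gh: "g \<in> carrier G" "h \<in> carrier G" for g h
  proof -
    have "inv\<^bsub>G\<^esub> g \<otimes>\<^bsub>G\<^esub> h \<in> carrier G" using gh G.inv_closed G.m_closed by blast
    from C[OF this] obtain ws where ws: "int (length ws) \<le> l1_norm n (fst (inv\<^bsub>G\<^esub> g \<otimes>\<^bsub>G\<^esub> h)) + int C"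
      "set ws \<subseteq> gens \<union> m_inv G ` gens" "foldr (\<otimes>\<^bsub>G\<^esub>) ws \<one>\<^bsub>G\<^esub> = inv\<^bsub>G\<^esub> g \<otimes>\<^bsub>G\<^esub> h" by blast
    have "word_dist G gens g h \<le> length ws"
      by (rule G.word_dist_le) (use ws in auto)
    with ws(1) l1_norm_inv_mult[OF gh] show ?thesis by linarith
  qed
  then show ?thesis by blast
qed

text \<open>The center is computed in the projection and lifted with trivial component in
  \<open>F\<close>. Any discrepancy in the finite component is covered by \<open>C\<close>.\<close>

lemma rips_centers:
  fixes C t :: nat
  assumes C: "\<And>g h. g \<in> carrier G \<Longrightarrow> h \<in> carrier G \<Longrightarrow>
      int (word_dist G gens g h) \<le> l1_norm n (\<lambda>i. fst g i - fst h i) + int C"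
    and t: "2 ^ n * (2 * n + C + 1) \<le> t"
    and AB: "A \<subseteq> B" "A \<noteq> {}"
    and B: "B \<in> rips_complex (carrier G) (\<lambda>g h. real (word_dist G gens g h)) (real (Suc t))"
  defines "z \<equiv> \<lambda>A. (l1_center n (fst ` A), \<one>)"
  shows "z A \<in> carrier G \<and>
    (\<forall>v\<in>A. word_dist G gens (z A) v \<le> t \<and> word_dist G gens v (z A) \<le> t) \<and>
    word_dist G gens (z A) (z B) \<le> t \<and> word_dist G gens (z B) (z A) \<le> t"
proof -
  have fin: "finite B" and BG: "B \<subseteq> carrier G"
    and diam: "\<And>x y. x \<in> B \<Longrightarrow> y \<in> B \<Longrightarrow> word_dist G gens x y \<le> Suc t"
    using B unfolding rips_complex_iff_pairwise of_nat_le_iff by blast+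
  have zG: "z X \<in> carrier G" for X
    by (simp add: z_def l1_center_def)
  have le: "word_dist G gens g h \<le> t \<and> word_dist G gens h g \<le> t"
    if "g \<in> carrier G" "h \<in> carrier G" "l1_norm n (\<lambda>i. fst g i - fst h i) + int C \<le> int t" for g h
    using C[OF that(1,2)] C[OF that(2,1)] that(3) l1_norm_commute[of n "fst g" "fst h"] by linarith
  have finB: "finite (fst ` B)" and AB': "fst ` A \<subseteq> fst ` B" "fst ` A \<noteq> {}"
    using fin AB by auto
  have diam': "l1_norm n (\<lambda>i. x i - y i) \<le> int (Suc t)" if xy: "x \<in> fst ` B" "y \<in> fst ` B" for x y
  proof -
    obtain g h where gh: "g \<in> B" "h \<in> B" "x = fst g" "y = fst h" using xy by blast
    then have "l1_norm n (\<lambda>i. x i - y i) \<le> int (word_dist G gens g h)"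
      using l1_norm_le_word_dist[OF subsetD[OF BG gh(1)] subsetD[OF BG gh(2)]] by simp
    with diam[OF gh(1,2)] show ?thesis by linarith
  qed
  have "word_dist G gens (z A) v \<le> t \<and> word_dist G gens v (z A) \<le> t" if v: "v \<in> A" for v
  proof -
    have "l1_norm n (\<lambda>i. fst v i - fst (z A) i) + int C \<le> int t"
      unfolding z_def fst_conv by (rule l1_center_close(1)[OF finB AB' diam' t imageI[OF v]])
    from le[OF subsetD[OF BG subsetD[OF AB(1) v]] zG this] show ?thesis by simp
  qed
  moreover have "l1_norm n (\<lambda>i. fst (z B) i - fst (z A) i) + int C \<le> int t"
    unfolding z_def fst_conv by (rule l1_center_close(2)[OF finB AB' diam' t])
  note le[OF zG zG this]
  ultimately show ?thesis
    using zG by (intro conjI ballI) simp_all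
qed

theorem type_R_G: "type_R G gens"
  unfolding type_R_def
proof
  show "marked_group G gens"
    by unfold_locales (rule finite_gens gens_subset generate_gens)+
  obtain C :: nat where C: "\<And>g h. g \<in> carrier G \<Longrightarrow> h \<in> carrier G \<Longrightarrow>
      int (word_dist G gens g h) \<le> l1_norm n (\<lambda>i. fst g i - fst h i) + int C"
    using word_dist_le_l1_norm by blast
  let ?r0 = "2 ^ n * (2 * n + C + 1)"
  have "contractible_space (geometric_realization
      (rips_complex (carrier G) (\<lambda>g h. real (word_dist G gens g h)) r))" if r: "real ?r0 \<le> r" for r
  proof -
    have "0 \<le> r" using r of_nat_0_le_iff order_trans by blast
    \<comment> \<open>The threshold is an integer, so it survives rounding the radius down; every
      larger integer radius then satisfies it too, as the descent to this complex requires.\<close>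
    have "?r0 \<le> nat \<lfloor>r\<rfloor>" using r by (rule le_nat_floor)
    then have "contractible_space (geometric_realization
      (rips_complex (carrier G) (\<lambda>g h. real (word_dist G gens g h)) (real (nat \<lfloor>r\<rfloor>))))"
      by (intro contractible_rips_complex_nat exI[of _ "\<lambda>A. (l1_center n (fst ` A), \<one>)"]
          allI impI rips_centers[OF C]) auto
    then show ?thesis by (simp only: rips_complex_floor[OF \<open>0 \<le> r\<close>])
  qed
  then show "\<exists>r0::real. r0 \<ge> 0 \<and> (\<forall>r\<ge>r0. contractible_space
      (geometric_realization (rips_complex (carrier G) (\<lambda>g h. real (word_dist G gens g h)) r)))"
    by (intro exI[of _ "real ?r0"]) simp
qed

end
theorem theorem1p6:
  fixes n :: nat
    and F :: "('a, 'b) monoid_scheme"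
    and T :: "'a set"
  assumes "group F"
    and "finite (carrier F)"
    and "T \<subseteq> carrier F"
    and "generate F T = carrier F"
  shows "type_R (Z_pow n \<times>\<times> F)
           (std_gens n \<times> {\<one>\<^bsub>F\<^esub>} \<union> {\<one>\<^bsub>Z_pow n\<^esub>} \<times> T)"
proof -
  interpret group F by fact
  interpret Z_pow_times_finite F n T
    by unfold_locales (rule assms)+
  show ?thesis using type_R_G by (simp only: gens_def)
qed

end
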